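(* Let $d\geq1$, $k\geq1$, $(\boldsymbol\mu,\rho)\in\mathbb{S}^d\times[-1,1]$, $\boldsymbol X\sim\mathrm{C}_k(\boldsymbol\mu,\rho)$ and $\boldsymbol\gamma\in\mathbb{S}^d$. Then the density and cdf of $\boldsymbol\gamma^\top\boldsymbol X$ on $[-1,1]$ are $$f_{\boldsymbol\gamma}(x)=f_d(x)\big\{1+\rho\,\tilde C_k^{(d-1)/2}(\boldsymbol\gamma^\top\boldsymbol\mu)\tilde C_k^{(d-1)/2}(x)\big\},\qquad F_{\boldsymbol\gamma}(x)=F_d(x)-\rho\,\eta_k(\boldsymbol\gamma^\top\boldsymbol\mu)G_k(x),$$ where $f_d(x)=\frac{\omega_{d-1}}{\omega_d}(1-x^2)^{d/2-1}$, $F_d(x)=\int_{-1}^xf_d(t)\,\mathrm dt$, $\eta_k(s)=\frac{\omega_{d-1}}{\omega_d}\frac{C_k^{(d-1)/2}(s)}{\{C_k^{(d-1)/2}(1)\}^2}$, and $G_k(x)=\frac1k\sin(k\cos^{-1}x)$ if $d=1$, $G_k(x)=\frac{d-1}{k(k+d-1)}C_{k-1}^{(d+1)/2}(x)(1-x^2)^{d/2}$ if $d\geq2$.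
   Context: For $d\geq1$, $\mathbb{S}^d$ is the unit sphere of $\mathbb{R}^{d+1}$ with surface area measure $\sigma_d$ and total area $\omega_d=2\pi^{(d+1)/2}/\Gamma((d+1)/2)$ (with $\omega_0=2$). For $\lambda>0$, $C_k^{\lambda}$ is the standard Gegenbauer polynomial of degree $k$ and index $\lambda$ (generating function $(1-2xt+t^2)^{-\lambda}$); for $d=1$, $C_k^0:=T_k$, $T_k(x)=\cos(k\cos^{-1}x)$. $\tilde C_k^{(d-1)/2}=C_k^{(d-1)/2}/C_k^{(d-1)/2}(1)$. $\mathrm{C}_k(\boldsymbol\mu,\rho)$ is the distribution on $\mathbb{S}^d$ with density $\omega_d^{-1}\{1+\rho\,\tilde C_k^{(d-1)/2}(\boldsymbol x^\top\boldsymbol\mu)\}$ w.r.t. $\sigma_d$. *)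

theory Defs
  imports "HOL-Probability.Probability"
begin

text \<open>Total surface area of the unit sphere S^m in R^(m+1); omega 0 = 2.\<close>
definition omega :: "nat \<Rightarrow> real" where
  "omega m = 2 * pi powr ((real m + 1) / 2) / Gamma ((real m + 1) / 2)"

text \<open>Gegenbauer polynomial C_n^lam: the coefficient of t^n in (1 - 2xt + t^2)^(-lam).\<close>
definition gegenbauer :: "real \<Rightarrow> nat \<Rightarrow> real \<Rightarrow> real" where
  "gegenbauer lam n x =
     (\<Sum>j\<le>n div 2. (-1) ^ j * pochhammer lam (n - j) / (fact j * fact (n - 2 * j))
                     * (2 * x) ^ (n - 2 * j))"

text \<open>C_k^((d-1)/2), with the convention C_k^0 := T_k (Chebyshev) for d = 1.\<close>
definition gegen_d :: "nat \<Rightarrow> nat \<Rightarrow> real \<Rightarrow> real" where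
  "gegen_d d k x = (if d = 1 then cos (real k * arccos x)
                    else gegenbauer ((real d - 1) / 2) k x)"

definition gegen_tilde :: "nat \<Rightarrow> nat \<Rightarrow> real \<Rightarrow> real" where
  "gegen_tilde d k x = gegen_d d k x / gegen_d d k 1"

text \<open>Surface area measure sigma_d on S^d, where the sphere lives in real^'n with
  CARD('n) = d + 1; realised as the cone measure:
  sigma(A) = (d+1) * Lebesgue measure of {x : 0 < |x| < 1, x/|x| in A}.\<close>
definition sphere_measure :: "(real ^ 'n) measure" where
  "sphere_measure =
     density (distr (restrict_space lborel (ball 0 1 - {0})) borel (\<lambda>x. x /\<^sub>R norm x))
             (\<lambda>_. ennreal (real CARD('n)))"

definition C_dist :: "nat \<Rightarrow> real ^ 'n \<Rightarrow> real \<Rightarrow> (real ^ 'n) measure" where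
  "C_dist k mu rho =
     (let d = CARD('n) - 1 in
      density sphere_measure
        (\<lambda>x. ennreal ((1 + rho * gegen_tilde d k (x \<bullet> mu)) / omega d)))"

definition f_d :: "nat \<Rightarrow> real \<Rightarrow> real" where
  "f_d d x = omega (d - 1) / omega d * (1 - x\<^sup>2) powr (real d / 2 - 1)"

definition F_d :: "nat \<Rightarrow> real \<Rightarrow> real" where
  "F_d d x = (LINT t:{-1..x}|lborel. f_d d t)"

definition eta :: "nat \<Rightarrow> nat \<Rightarrow> real \<Rightarrow> real" where
  "eta d k s = omega (d - 1) / omega d * gegen_d d k s / (gegen_d d k 1)\<^sup>2"

definition G :: "nat \<Rightarrow> nat \<Rightarrow> real \<Rightarrow> real" where
  "G d k x = (if d = 1 then sin (real k * arccos x) / real k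
              else (real d - 1) / (real k * (real k + real d - 1))
                   * gegenbauer ((real d + 1) / 2) (k - 1) x * (1 - x\<^sup>2) powr (real d / 2))"

end

theory Submission
  imports Defs
begin

text \<open>
  Write \<open>\<kappa>\<^sub>N\<close> for the integral of \<open>(u \<bullet> x)\<^sup>N\<close> over the sphere, which by rotation invariance
  is the same for all unit vectors \<open>u\<close>. Expanding \<open>|a u + v|\<^sup>N \<kappa>\<^sub>N\<close> in powers of \<open>a\<close> gives
  recurrences for the mixed moments of \<open>(u \<bullet> x, v \<bullet> x)\<close>, and these say that the Gegenbauer operator
  \<open>L p = (1 - x\<^sup>2) p'' - d x p'\<close> may be moved from a polynomial in \<open>u \<bullet> x\<close> to one in \<open>v \<bullet> x\<close>.
  Hence, if \<open>P\<close> is an eigenfunction of \<open>L\<close>, the moments \<open>\<integral> (u \<bullet> x)\<^sup>m P(v \<bullet> x)\<close> satisfy a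
  two-term recurrence that determines them up to a factor independent of \<open>m\<close>; concentrating
  at the pole \<open>x = u\<close> identifies this factor as \<open>P(u \<bullet> v) / P(1)\<close> times that of \<open>v = u\<close>.
  The moments \<open>\<kappa>\<^sub>N\<close> themselves obey the recurrence of the moments of \<open>(1 - t\<^sup>2)\<^bsup>d/2-1\<^esup>\<close>, so the two
  laws have equal moments and are equal, being supported on a bounded interval. The distribution
  function is obtained from \<open>((1 - t\<^sup>2)\<^bsup>d/2\<^esup> P')' = - k (k + d - 1) (1 - t\<^sup>2)\<^bsup>d/2-1\<^esup> P\<close>.
\<close>

section \<open>Gegenbauer polynomials\<close>

definition eigenval :: "nat \<Rightarrow> nat \<Rightarrow> real" where
  "eigenval d k = real k * (real k + real d - 1)"

text \<open>On a function p(v . x) with v a unit vector, the Laplace-Beltrami operator of the sphere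
  of dimension d acts as p -> L p; \<open>- eigenval d k\<close> is its eigenvalue on spherical
  harmonics of degree k.\<close>

definition gegen_op :: "nat \<Rightarrow> real poly \<Rightarrow> real poly" where
  "gegen_op d p = [:1, 0, -1:] * pderiv (pderiv p) - smult (real d) ([:0, 1:] * pderiv p)"

lemma poly_gegen_op:
  "poly (gegen_op d p) x = (1 - x\<^sup>2) * poly (pderiv (pderiv p)) x - real d * x * poly (pderiv p) x"
  by (simp add: gegen_op_def algebra_simps power2_eq_square)

lemma coeff_gegen_op:
  "coeff (gegen_op d p) l = real (l + 2) * real (l + 1) * coeff p (l + 2) - eigenval d l * coeff p l"
  by (auto simp: gegen_op_def eigenval_def coeff_pCons coeff_pderiv algebra_simps split: nat.splits)

lemma gegen_op_add: "gegen_op d (p + q) = gegen_op d p + gegen_op d q"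
  by (rule poly_eqI) (simp add: coeff_gegen_op algebra_simps)

text \<open>For l <= 1 the truncated exponent l - 2 is harmless, because its coefficient contains l
  (l - 1) = 0.\<close>

lemma gegen_op_monom:
  "gegen_op d (monom c l) =
     monom (c * real l * (real l - 1)) (l - 2) - monom (c * eigenval d l) l"
  by (rule poly_eqI) (auto simp: coeff_gegen_op le_Suc_eq numeral_2_eq_2)

lemma eigenval_eq_iff:
  assumes "d \<ge> 1"
  shows "eigenval d m = eigenval d k \<longleftrightarrow> m = k"
proof
  assume "eigenval d m = eigenval d k"
  then have "(real m - real k) * (real m + real k + real d - 1) = 0"
    by (simp add: eigenval_def algebra_simps)
  \<comment> \<open>For d = 1 the factor is m + k, which vanishes only for m = k = 0.\<close>
  moreover have "real m + real k + real d - 1 \<noteq> 0" if "m \<noteq> k"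
    using that assms by linarith
  ultimately show "m = k" by auto
qed auto

text \<open>L multiplies the leading coefficient by \<open>- eigenval d (degree P)\<close>, and
  different degrees have different eigenvalues.\<close>

lemma gegen_op_eigen_degree:
  assumes "d \<ge> 1" "P \<noteq> 0" and eig: "gegen_op d P = smult (- eigenval d k) P"
  shows "degree P = k"
proof -
  have "coeff (gegen_op d P) (degree P) = - eigenval d k * coeff P (degree P)"
    by (simp add: eig)
  then have "eigenval d (degree P) * lead_coeff P = eigenval d k * lead_coeff P"
    by (simp add: coeff_gegen_op coeff_eq_0 del: mult_cancel_right)
  then have "eigenval d (degree P) = eigenval d k"
    using assms(2) by simp
  then show ?thesis using assms by (simp add: eigenval_eq_iff)
qed

text \<open>Sonin's argument: the energy f = lambda P^2 + (1 - t^2) P'^2 has, by the differential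
  equation, derivative 2 (d - 1) t P'^2. It therefore grows away from 0 in both directions and is
  largest at an endpoint, where only lambda P^2 remains.\<close>

lemma gegen_op_eigen_abs_le:
  assumes "d \<ge> 1" "k \<ge> 1" and eig: "gegen_op d P = smult (- eigenval d k) P"
    and sym: "\<bar>poly P (-1)\<bar> = \<bar>poly P 1\<bar>" and x: "x \<in> {-1..1}"
  shows "\<bar>poly P x\<bar> \<le> \<bar>poly P 1\<bar>"
proof -
  define f where "f t = eigenval d k * (poly P t)\<^sup>2 + (1 - t\<^sup>2) * (poly (pderiv P) t)\<^sup>2" for t
  have lam: "eigenval d k > 0" using assms by (simp add: eigenval_def)
  have ode: "(1 - t\<^sup>2) * poly (pderiv (pderiv P)) t - real d * t * poly (pderiv P) t
      = - eigenval d k * poly P t" for t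
    using arg_cong[OF eig, of "\<lambda>q. poly q t"] by (simp add: poly_gegen_op)
  have der: "(f has_real_derivative 2 * (real d - 1) * t * (poly (pderiv P) t)\<^sup>2) (at t)" for t
  proof -
    have "(f has_real_derivative 2 * eigenval d k * poly P t * poly (pderiv P) t
       - 2 * t * (poly (pderiv P) t)\<^sup>2 + 2 * (1 - t\<^sup>2) * poly (pderiv P) t * poly (pderiv (pderiv P)) t) (at t)"
      unfolding f_def by (auto intro!: derivative_eq_intros simp: algebra_simps power2_eq_square)
    moreover have "2 * eigenval d k * poly P t * poly (pderiv P) t
       - 2 * t * (poly (pderiv P) t)\<^sup>2 + 2 * (1 - t\<^sup>2) * poly (pderiv P) t * poly (pderiv (pderiv P)) t
       = 2 * (real d - 1) * t * (poly (pderiv P) t)\<^sup>2"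
      using ode[of t] by algebra
    ultimately show ?thesis by simp
  qed
  have "f x \<le> f 1 \<or> f x \<le> f (-1)"
  proof (cases "x \<ge> 0")
    case True
    have "f x \<le> f 1"
    proof (rule DERIV_nonneg_imp_nondecreasing[of x 1 f])
      fix t assume "x \<le> t"
      with True have "2 * (real d - 1) * t * (poly (pderiv P) t)\<^sup>2 \<ge> 0"
        using assms(1) by auto
      then show "\<exists>y. (f has_real_derivative y) (at t) \<and> y \<ge> 0" using der by blast
    qed (use x in auto)
    then show ?thesis ..
  next
    case False
    have "f x \<le> f (-1)"
    proof (rule DERIV_nonpos_imp_nonincreasing[of "-1" x f])
      fix t assume "t \<le> x"
      with False have "2 * (real d - 1) * t * (poly (pderiv P) t)\<^sup>2 \<le> 0"
        using assms(1) by (intro mult_nonpos_nonneg mult_nonneg_nonpos) auto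
      then show "\<exists>y. (f has_real_derivative y) (at t) \<and> y \<le> 0" using der by blast
    qed (use x in auto)
    then show ?thesis ..
  qed
  moreover have "f 1 = eigenval d k * (poly P 1)\<^sup>2" "f (-1) = eigenval d k * (poly P 1)\<^sup>2"
    using sym by (auto simp: f_def power2_eq_iff abs_eq_iff)
  moreover have "eigenval d k * (poly P x)\<^sup>2 \<le> f x"
    using x by (simp add: f_def abs_square_le_1 abs_le_iff)
  ultimately have "eigenval d k * (poly P x)\<^sup>2 \<le> eigenval d k * (poly P 1)\<^sup>2"
    by linarith
  then show ?thesis using lam by (simp add: abs_le_square_iff)
qed

text \<open>If P(1) were 0, the preceding bound would make P vanish on all of [-1,1]. This allows
  division by P(1).\<close>

lemma gegen_op_eigen_at_1:
  assumes "d \<ge> 1" "k \<ge> 1" "P \<noteq> 0" and eig: "gegen_op d P = smult (- eigenval d k) P"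
    and sym: "\<bar>poly P (-1)\<bar> = \<bar>poly P 1\<bar>"
  shows "poly P 1 \<noteq> 0"
proof
  assume "poly P 1 = 0"
  then have "{-1..1} \<subseteq> {x. poly P x = 0}"
    using gegen_op_eigen_abs_le[OF assms(1,2) eig sym] by auto
  then have "finite {-1..1::real}"
    using poly_roots_finite[OF \<open>P \<noteq> 0\<close>] finite_subset by blast
  then show False by (simp add: infinite_Icc)
qed

text \<open>The recurrence yields a m from a (m - 2) except at the resonance m = k, where the factor
  of a m cancels. There the hypothesis on the coefficients of P takes over: all lower terms are
  already 0 and the leading coefficient, of index k, is not.\<close>

lemma moments_eq_0:
  fixes a :: "nat \<Rightarrow> real" and P :: "real poly"
  assumes "d \<ge> 1" "P \<noteq> 0" and eig: "gegen_op d P = smult (- eigenval d k) P"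
    and rec: "\<And>m. real m * (real m - 1) * a (m - 2) - eigenval d m * a m = - eigenval d k * a m"
    and P: "(\<Sum>l\<le>degree P. coeff P l * a l) = 0"
  shows "a m = 0"
proof -
  have deg: "degree P = k" by (rule gegen_op_eigen_degree[OF assms(1-3)])
  have step: "a m = 0" if "\<And>j. j < m \<Longrightarrow> a j = 0" "m \<noteq> k" for m
  proof -
    have "real m * (real m - 1) * a (m - 2) = 0"
      using that(1)[of "m - 2"] by (cases "m \<le> 1") (auto simp: le_Suc_eq)
    then have "eigenval d m * a m = eigenval d k * a m"
      using rec[of m] by linarith
    then show ?thesis using eigenval_eq_iff[OF assms(1)] that(2) by auto
  qed
  show ?thesis
  proof (induction m rule: less_induct)
    case (less m)
    show ?case
    proof (cases "m = k")
      case True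
      have "(\<Sum>l\<le>k. coeff P l * a l) = coeff P k * a k"
        using less True by (subst sum.remove[of _ k]) (auto intro!: sum.neutral)
      moreover have "coeff P k \<noteq> 0" using assms(2) deg by auto
      ultimately show ?thesis using P deg True by simp
    qed (use step less in auto)
  qed
qed

section \<open>Gegenbauer polynomials and their differential equation\<close>

definition gegen_poly :: "real \<Rightarrow> nat \<Rightarrow> real poly" where
  "gegen_poly lam n = (\<Sum>j\<le>n div 2.
     monom ((-1) ^ j * pochhammer lam (n - j) / (fact j * fact (n - 2 * j)) * 2 ^ (n - 2 * j)) (n - 2 * j))"

lemma poly_gegen_poly: "poly (gegen_poly lam n) x = gegenbauer lam n x"
  by (simp add: gegen_poly_def gegenbauer_def poly_sum poly_monom power_mult_distrib mult_ac)

text \<open>Every exponent n - 2 j has the parity of n.\<close>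

lemma gegenbauer_minus: "gegenbauer lam n (- x) = (-1) ^ n * gegenbauer lam n x"
  unfolding gegenbauer_def sum_distrib_left
proof (rule sum.cong, goal_cases)
  case (2 j)
  have "(- 1) ^ n * (2 * x) ^ (n - 2 * j) = ((- 1) ^ (2 * j + (n - 2 * j))) * (2 * x) ^ (n - 2 * j)"
    using 2 by simp
  also have "\<dots> = (2 * (- x)) ^ (n - 2 * j)"
    using power_mult_distrib[of "-1" "2 * x" "n - 2 * j"] by (simp add: power_add power_mult)
  finally show ?case by (simp add: mult_ac del: power_mult_distrib)
qed auto

lemma pderiv_gegen_poly:
  "pderiv (gegen_poly lam (Suc n)) = smult (2 * lam) (gegen_poly (lam + 1) n)"
proof -
  have "poly (pderiv (gegen_poly lam (Suc n))) x = poly (smult (2 * lam) (gegen_poly (lam + 1) n)) x" for x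
  proof -
    have "poly (pderiv (gegen_poly lam (Suc n))) x =
      (\<Sum>j\<le>Suc n div 2. (-1) ^ j * pochhammer lam (Suc n - j) / (fact j * fact (Suc n - 2 * j))
          * 2 ^ (Suc n - 2 * j) * real (Suc n - 2 * j) * x ^ (Suc n - 2 * j - 1))"
      by (simp add: gegen_poly_def higher_pderiv_sum[of 1, simplified] poly_sum pderiv_monom poly_monom mult_ac)
    \<comment> \<open>If Suc n is even, the last term of the sum is constant and disappears under
      differentiation.\<close>
    also have "\<dots> = (\<Sum>j\<le>n div 2. (-1) ^ j * pochhammer lam (Suc n - j) / (fact j * fact (Suc n - 2 * j))
          * 2 ^ (Suc n - 2 * j) * real (Suc n - 2 * j) * x ^ (Suc n - 2 * j - 1))"
    proof (rule sum.mono_neutral_right)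
      show "\<forall>i\<in>{..Suc n div 2} - {..n div 2}. (- 1) ^ i * pochhammer lam (Suc n - i) / (fact i * fact (Suc n - 2 * i)) *
         2 ^ (Suc n - 2 * i) * real (Suc n - 2 * i) * x ^ (Suc n - 2 * i - 1) = 0"
      proof
        fix i assume "i \<in> {..Suc n div 2} - {..n div 2}"
        then have "Suc n - 2 * i = 0" by auto
        then show "(- 1) ^ i * pochhammer lam (Suc n - i) / (fact i * fact (Suc n - 2 * i)) *
         2 ^ (Suc n - 2 * i) * real (Suc n - 2 * i) * x ^ (Suc n - 2 * i - 1) = 0" by simp
      qed
    qed auto
    also have "\<dots> = (\<Sum>j\<le>n div 2. 2 * lam * ((-1) ^ j * pochhammer (lam + 1) (n - j) / (fact j * fact (n - 2 * j))
          * (2 * x) ^ (n - 2 * j)))"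
    proof (rule sum.cong, goal_cases)
      case (2 j)
      then have j: "2 * j \<le> n" "j \<le> n" by auto
      have e: "Suc n - 2 * j = Suc (n - 2 * j)" "Suc n - j = Suc (n - j)" using j by auto
      show ?case unfolding e pochhammer_rec
        by (simp add: field_simps power_mult_distrib del: of_nat_Suc)
    qed auto
    also have "\<dots> = poly (smult (2 * lam) (gegen_poly (lam + 1) n)) x"
      by (simp add: poly_gegen_poly gegenbauer_def sum_distrib_left)
    finally show ?thesis .
  qed
  then show ?thesis by (simp add: poly_eq_poly_eq_iff[symmetric] fun_eq_iff)
qed

text \<open>Only j = 0 contributes to the coefficient of x^n. For lam = 0 and n >= 1 all
  coefficients would be 0, which is why d = 1 is handled by Chebyshev polynomials.\<close>

lemma gegen_poly_nonzero:
  assumes "lam > 0"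
  shows "gegen_poly lam n \<noteq> 0"
proof -
  have "coeff (gegen_poly lam n) n =
     (\<Sum>j\<le>n div 2. if j = 0 then pochhammer lam n / fact n * 2 ^ n else 0)"
    unfolding gegen_poly_def coeff_sum
    by (rule sum.cong) auto
  also have "\<dots> = pochhammer lam n / fact n * 2 ^ n" by simp
  also have "\<dots> \<noteq> 0" using pochhammer_pos[OF assms, of n] by simp
  finally show ?thesis by auto
qed

text \<open>L + lambda sends the j-th monomial of C_k to a multiple of itself, \<open>b j\<close>,
  plus a term of degree lower by two, which is \<open>- b (Suc j)\<close>. The sum telescopes to
  \<open>b 0\<close>, and this is 0 because its eigenvalue difference is that of k with
  itself.\<close>

lemma gegen_op_gegen_poly:
  assumes "d \<ge> 1"
  shows "gegen_op d (gegen_poly ((real d - 1) / 2) k) =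
    smult (- eigenval d k) (gegen_poly ((real d - 1) / 2) k)"
proof -
  define lam where "lam = (real d - 1) / 2"
  define c where "c j = (-1) ^ j * pochhammer lam (k - j) / (fact j * fact (k - 2 * j)) * 2 ^ (k - 2 * j)" for j
  define b where "b j = monom (c j * (eigenval d k - eigenval d (k - 2 * j))) (k - 2 * j)" for j
  define K where "K = k div 2"
  have gp: "gegen_poly lam k = (\<Sum>j\<le>K. monom (c j) (k - 2 * j))"
    by (simp add: gegen_poly_def c_def K_def)
  have opsum: "gegen_op d (\<Sum>j\<in>A. f j) = (\<Sum>j\<in>A. gegen_op d (f j))" if "finite A" for A :: "nat set" and f
    using that by induction (auto simp: gegen_op_add, simp add: gegen_op_def)
  have smult_sum': "smult a (\<Sum>j\<in>A. f j) = (\<Sum>j\<in>A. smult a (f j))" if "finite A"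
    for A :: "nat set" and f and a :: real
    using that by induction (auto simp: smult_add_right)
  have telescope: "gegen_op d (monom (c j) (k - 2 * j)) + smult (eigenval d k) (monom (c j) (k - 2 * j))
      = b j - (if j < K then b (Suc j) else 0)" if "j \<le> K" for j
  proof (cases "j < K")
    case True
    then have j: "2 * j + 2 \<le> k" by (auto simp: K_def)
    define m where "m = k - 2 * j - 2"
    have m: "k = m + 2 * j + 2" "k - 2 * j = m + 2" "k - 2 * Suc j = m" "k - j = Suc (m + j + 1)" "k - Suc j = m + j + 1"
      using j by (auto simp: m_def)
    have lam2: "real d = 2 * lam + 1" by (simp add: lam_def field_simps)
    \<comment> \<open>The ratio of consecutive coefficients of C_k. With k = m + 2 j + 2 the
      eigenvalue difference factors as (k - m) (k + m + d - 1), which supplies the factors that j!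
      and the Pochhammer symbol change by.\<close>
    have cc: "c j * (real m + 2) * (real m + 1) = - c (Suc j) * (eigenval d k - eigenval d m)"
    proof -
      have "eigenval d k - eigenval d m = 4 * real (Suc j) * (lam + real (m + j + 1))"
        by (simp add: m(1) eigenval_def lam2 algebra_simps)
      then show ?thesis
        by (simp add: c_def m pochhammer_Suc fact_Suc field_simps del: of_nat_Suc of_nat_add)
           (simp add: algebra_simps)
    qed
    show ?thesis
      using True cc
      by (simp add: gegen_op_monom b_def m smult_monom add_monom diff_monom minus_monom algebra_simps)

  next
    case False
    \<comment> \<open>At the end of the sum the exponent is 0 or 1, so the second derivative
      vanishes and there is nothing left to cancel.\<close>
    then have "k - 2 * j = 0 \<or> k - 2 * j = 1" using that by (auto simp: K_def)
    then have "real (k - 2 * j) * (real (k - 2 * j) - 1) = 0" by auto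
    then have "monom (c j * real (k - 2 * j) * (real (k - 2 * j) - 1)) (k - 2 * j - 2) = 0"
      by (simp only: mult.assoc) simp
    then show ?thesis
      using False by (simp add: gegen_op_monom b_def smult_monom right_diff_distrib mult.commute flip: diff_monom)
  qed
  have "gegen_op d (gegen_poly lam k) + smult (eigenval d k) (gegen_poly lam k)
     = (\<Sum>j\<le>K. b j - (if j < K then b (Suc j) else 0))"
    unfolding gp opsum[OF finite_atMost] smult_sum'[OF finite_atMost] sum.distrib[symmetric]
    by (rule sum.cong) (use telescope in auto)
  also have "\<dots> = (\<Sum>j\<le>K. b j) - (\<Sum>j<K. b (Suc j))"
    by (simp add: sum_subtractf flip: lessThan_Suc_atMost)
  also have "\<dots> = b 0"
    unfolding lessThan_Suc_atMost[symmetric] sum.lessThan_Suc_shift by simp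
  also have "\<dots> = 0" by (simp add: b_def)
  finally show ?thesis
    unfolding lam_def by (simp add: add_eq_0_iff2)
qed

section \<open>Chebyshev polynomials, for d = 1\<close>

text \<open>The pair \<open>(T\<^sub>k, U\<^sub>k\<^sub>-\<^sub>1)\<close> of Chebyshev polynomials, with \<open>U\<^sub>-\<^sub>1 = 0\<close>.\<close>
fun cheb :: "nat \<Rightarrow> real poly \<times> real poly" where
  "cheb 0 = (1, 0)"
| "cheb (Suc k) = (case cheb k of (T, S) \<Rightarrow>
     ([:0, 1:] * T - [:1, 0, -1:] * S, [:0, 1:] * S + T))"

abbreviation "chebT k \<equiv> fst (cheb k)"
abbreviation "chebS k \<equiv> snd (cheb k)"

lemma cheb_Suc:
  "chebT (Suc k) = [:0, 1:] * chebT k - [:1, 0, -1:] * chebS k"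
  "chebS (Suc k) = [:0, 1:] * chebS k + chebT k"
  by (simp_all add: case_prod_beta)

declare cheb.simps(2) [simp del]

text \<open>The recursion of \<open>cheb\<close> consists of the addition theorems for cosine and
  sine, with sin t taken out of the sine part and sin^2 t written as 1 - cos^2 t.\<close>

lemma poly_cheb_cos:
  "poly (chebT k) (cos t) = cos (real k * t) \<and> sin t * poly (chebS k) (cos t) = sin (real k * t)"
proof (induction k)
  case (Suc k)
  have "1 - cos t * cos t = sin t * sin t"
    using sin_cos_squared_add[of t] by (simp add: power2_eq_square)
  moreover have "cos (real (Suc k) * t) = cos t * cos (real k * t) - sin t * sin (real k * t)"
    "sin (real (Suc k) * t) = sin t * cos (real k * t) + cos t * sin (real k * t)"
    by (simp_all add: distrib_right cos_add sin_add)
  moreover have "poly (chebT (Suc k)) (cos t) = cos t * poly (chebT k) (cos t) - (1 - cos t * cos t) * poly (chebS k) (cos t)"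
    "poly (chebS (Suc k)) (cos t) = cos t * poly (chebS k) (cos t) + poly (chebT k) (cos t)"
    by (simp_all add: cheb_Suc algebra_simps)
  ultimately show ?case
    using Suc \<open>1 - cos t * cos t = sin t * sin t\<close> by (simp add: algebra_simps)
qed auto

lemma poly_cheb_minus:
  "poly (chebT k) (- x) = (-1) ^ k * poly (chebT k) x \<and> poly (chebS k) (- x) = - ((-1) ^ k) * poly (chebS k) x"
  by (induction k) (auto simp: cheb_Suc algebra_simps)

text \<open>One induction for both identities, as each step differentiates T and S together. The
  second is multiplied by 1 - x^2 to stay polynomial; combined they give the Chebyshev differential
  equation.\<close>

lemma pderiv_cheb:
  "pderiv (chebT k) = smult (real k) (chebS k) \<and>
   [:1, 0, -1:] * pderiv (chebS k) = [:0, 1:] * chebS k - smult (real k) (chebT k)"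
proof (induction k)
  case 0
  then show ?case by simp
next
  case (Suc k)
  have a: "poly (pderiv (chebT k)) x = real k * poly (chebS k) x"
    "(1 - x * x) * poly (pderiv (chebS k)) x = x * poly (chebS k) x - real k * poly (chebT k) x" for x
    using arg_cong[OF conjunct1[OF Suc], of "\<lambda>p. poly p x"]
      arg_cong[OF conjunct2[OF Suc], of "\<lambda>p. poly p x"] by (simp_all add: algebra_simps)
  have "poly (pderiv (chebT (Suc k))) x = poly (smult (real (Suc k)) (chebS (Suc k))) x" for x
  proof -
    have "poly (pderiv (chebT (Suc k))) x = poly (chebT k) x + x * poly (pderiv (chebT k)) x
        + 2 * x * poly (chebS k) x - (1 - x * x) * poly (pderiv (chebS k)) x"
      unfolding cheb_Suc pderiv_diff pderiv_mult by (simp add: pderiv_pCons algebra_simps)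
    then show ?thesis
      unfolding a by (simp add: cheb_Suc algebra_simps)
  qed
  moreover have "poly ([:1, 0, -1:] * pderiv (chebS (Suc k))) x
     = poly ([:0, 1:] * chebS (Suc k) - smult (real (Suc k)) (chebT (Suc k))) x" for x
  proof -
    have "poly ([:1, 0, -1:] * pderiv (chebS (Suc k))) x = (1 - x * x) * (poly (chebS k) x + poly (pderiv (chebT k)) x)
        + x * ((1 - x * x) * poly (pderiv (chebS k)) x)"
      unfolding cheb_Suc pderiv_add pderiv_mult by (simp add: pderiv_pCons algebra_simps)
    then show ?thesis
      unfolding a by (simp add: cheb_Suc algebra_simps)
  qed
  ultimately show ?case by (simp add: poly_eq_poly_eq_iff[symmetric] fun_eq_iff)
qed

lemma gegen_op_cheb: "gegen_op 1 (chebT k) = smult (- eigenval 1 k) (chebT k)"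
proof -
  have "[:1, 0, -1:] * pderiv (pderiv (chebT k)) = smult (real k) ([:1, 0, -1:] * pderiv (chebS k))"
    using pderiv_cheb[of k] by (simp add: pderiv_smult)
  then show ?thesis
    using pderiv_cheb[of k]
    by (simp add: gegen_op_def eigenval_def smult_diff_right del: mult_pCons_left)
qed

section \<open>Common treatment of d = 1 and d >= 2\<close>

definition gegen_d_poly :: "nat \<Rightarrow> nat \<Rightarrow> real poly" where
  "gegen_d_poly d k = (if d = 1 then chebT k else gegen_poly ((real d - 1) / 2) k)"

lemma gegen_op_gegen_d_poly:
  assumes "d \<ge> 1"
  shows "gegen_op d (gegen_d_poly d k) = smult (- eigenval d k) (gegen_d_poly d k)"
  using assms gegen_op_cheb gegen_op_gegen_poly by (auto simp: gegen_d_poly_def)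

text \<open>The restriction to [-1,1] comes from \<open>arccos\<close> in the case d = 1.\<close>

lemma gegen_d_eq_poly:
  assumes "x \<in> {-1..1}"
  shows "gegen_d d k x = poly (gegen_d_poly d k) x"
  using assms poly_cheb_cos[of k "arccos x"]
  by (auto simp: gegen_d_def gegen_d_poly_def poly_gegen_poly)

lemma gegen_d_poly_nonzero:
  assumes "d \<ge> 1"
  shows "gegen_d_poly d k \<noteq> 0"
proof (cases "d = 1")
  case True
  then show ?thesis using poly_cheb_cos[of k 0] by (auto simp: gegen_d_poly_def)
next
  case False
  then show ?thesis using assms by (simp add: gegen_d_poly_def gegen_poly_nonzero)
qed

lemma gegen_d_poly_minus: "\<bar>poly (gegen_d_poly d k) (- x)\<bar> = \<bar>poly (gegen_d_poly d k) x\<bar>"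
  by (simp add: gegen_d_poly_def poly_gegen_poly gegenbauer_minus poly_cheb_minus abs_mult power_abs)

lemma gegen_d_poly_1_nonzero:
  assumes "d \<ge> 1" "k \<ge> 1"
  shows "poly (gegen_d_poly d k) 1 \<noteq> 0"
  by (rule gegen_op_eigen_at_1[OF assms gegen_d_poly_nonzero gegen_op_gegen_d_poly gegen_d_poly_minus])
    (rule assms)+

text \<open>This keeps the density 1 + rho C~ nonnegative, so that \<open>ennreal\<close> cuts
  nothing off.\<close>

lemma gegen_tilde_abs_le_1:
  assumes "d \<ge> 1" "k \<ge> 1" "x \<in> {-1..1}"
  shows "\<bar>gegen_tilde d k x\<bar> \<le> 1"
  using gegen_op_eigen_abs_le[OF assms(1,2) gegen_op_gegen_d_poly[OF assms(1)] gegen_d_poly_minus assms(3)]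
    gegen_d_poly_1_nonzero[OF assms(1,2)] assms
  by (simp add: gegen_tilde_def gegen_d_eq_poly abs_divide divide_le_eq_1)

text \<open>Brings both branches of \<open>G\<close> into the form that arises when P times the
  weight is integrated through the differential equation.\<close>

lemma G_eq:
  assumes "d \<ge> 1" "k \<ge> 1" "x \<in> {-1..1}"
  shows "G d k x = poly (pderiv (gegen_d_poly d k)) x * (1 - x\<^sup>2) powr (real d / 2) / eigenval d k"
proof (cases "d = 1")
  case True
  have sq: "(1 - x\<^sup>2) powr (1 / 2) = sin (arccos x)"
    using assms(3) by (simp add: powr_half_sqrt sin_arccos abs_square_le_1 abs_le_iff)
  have "sin (arccos x) * poly (chebS k) x = sin (real k * arccos x)"
    using poly_cheb_cos[of k "arccos x"] assms(3) by simp
  then show ?thesis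
    using True sq pderiv_cheb[of k] assms(2)
    by (simp add: G_def gegen_d_poly_def eigenval_def field_simps)
next
  case False
  obtain k' where k': "k = Suc k'" using assms(2) by (cases k) auto
  have e: "(real d - 1) / 2 + 1 = (real d + 1) / 2" by (simp add: field_simps)
  have "poly (pderiv (gegen_d_poly d k)) x = (real d - 1) * gegenbauer ((real d + 1) / 2) (k - 1) x"
    using False e by (simp add: gegen_d_poly_def k' pderiv_gegen_poly poly_gegen_poly field_simps)
  then show ?thesis
    using False by (simp add: G_def eigenval_def)
qed

section \<open>Surface measure of the sphere\<close>

text \<open>With \<open>B\<close> the unit ball, integrate \<open>1\<^sub>A(f x) 1\<^sub>B(f x - y)\<close> over \<open>x\<close> and \<open>y\<close> in both orders. The library's
  \<open>measure_orthogonal_image\<close> does not apply, as it needs a well-ordered index type.\<close>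
lemma lborel_distr_orthogonal:
  fixes f :: "'a::euclidean_space \<Rightarrow> 'a"
  assumes f: "orthogonal_transformation f"
  shows "distr lborel borel f = lborel"
proof (rule measure_eqI)
  obtain g where g: "orthogonal_transformation g" "\<And>x. f (g x) = x"
    using orthogonal_transformation_inv[OF f] orthogonal_transformation_surj[OF f]
    by (metis surj_f_inv_f)
  have lin: "linear f" by (rule orthogonal_transformation_linear[OF f])
  have [measurable]: "f \<in> borel_measurable borel"
    by (intro borel_measurable_continuous_onI linear_continuous_on linear_conv_bounded_linear[THEN iffD1] lin)
  have [measurable]: "ball (0::'a) 1 \<in> sets borel" by simp
  define c where "c = emeasure lborel (ball (0::'a) 1)"
  have c: "c \<noteq> 0" "c \<noteq> \<infinity>"
    using less_imp_neq[OF unit_ball_vol_pos[of "real DIM('a)"]] by (auto simp: c_def emeasure_ball)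
  have shift: "(\<integral>\<^sup>+x. h (x + a) \<partial>lborel) = (\<integral>\<^sup>+x. h x \<partial>lborel)"
    if [measurable]: "h \<in> borel_measurable borel" for h :: "'a \<Rightarrow> ennreal" and a
    by (subst (2) lborel_distr_plus[of a, symmetric]) (simp add: nn_integral_distr add.commute)
  fix A assume "A \<in> sets (distr lborel borel f)"
  then have [measurable]: "A \<in> sets borel" by simp
  have "c * emeasure (distr lborel borel f) A
      = (\<integral>\<^sup>+x. indicator A (f x) * c \<partial>lborel)"
    by (subst nn_integral_multc, measurable)
      (simp add: nn_integral_distr mult.commute flip: nn_integral_indicator)
  also have "\<dots> = (\<integral>\<^sup>+x. (\<integral>\<^sup>+y. indicator A (f x) * indicator (ball 0 1) (f x - y) \<partial>lborel) \<partial>lborel)"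
  proof (rule nn_integral_cong)
    fix x
    have "indicator (ball 0 1) (f x - y) = (indicator (ball (f x) 1) y :: ennreal)" for y
      by (auto simp: indicator_def dist_norm norm_minus_commute)
    then show "indicator A (f x) * c = (\<integral>\<^sup>+y. indicator A (f x) * indicator (ball 0 1) (f x - y) \<partial>lborel)"
      by (simp only: nn_integral_cmult_indicator borel_open open_ball sets_lborel)
         (simp add: c_def emeasure_ball)
  qed
  also have "\<dots> = (\<integral>\<^sup>+y. (\<integral>\<^sup>+x. indicator A (f x) * indicator (ball 0 1) (f x - y) \<partial>lborel) \<partial>lborel)"
    by (rule lborel_pair.Fubini') measurable
  also have "\<dots> = (\<integral>\<^sup>+y. (\<integral>\<^sup>+x. indicator A (f x + y) * indicator (ball 0 1) (f x) \<partial>lborel) \<partial>lborel)"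
  proof (rule nn_integral_cong)
    \<comment> \<open>Translating x by \<open>g y\<close> turns \<open>f x\<close> into
      \<open>f x + y\<close>, which moves y from the ball to A.\<close>
    fix y
    show "(\<integral>\<^sup>+x. indicator A (f x) * indicator (ball 0 1) (f x - y) \<partial>lborel)
      = (\<integral>\<^sup>+x. indicator A (f x + y) * indicator (ball 0 1) (f x) \<partial>lborel)"
      by (subst shift[of _ "g y", symmetric]) (auto simp: linear_add[OF lin] g(2))
  qed
  also have "\<dots> = (\<integral>\<^sup>+x. (\<integral>\<^sup>+y. indicator A (f x + y) * indicator (ball 0 1) (f x) \<partial>lborel) \<partial>lborel)"
    by (rule lborel_pair.Fubini') measurable
  also have "\<dots> = (\<integral>\<^sup>+x. emeasure lborel A * indicator (ball (0::'a) 1) x \<partial>lborel)"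
  proof (rule nn_integral_cong)
    fix x
    have "(\<integral>\<^sup>+y. indicator A (f x + y) \<partial>lborel) = emeasure lborel A"
      by (subst add.commute, subst shift) auto
    then show "(\<integral>\<^sup>+y. indicator A (f x + y) * indicator (ball 0 1) (f x) \<partial>lborel)
      = emeasure lborel A * indicator (ball 0 1) x"
      by (subst nn_integral_multc) (auto simp: indicator_def orthogonal_transformation_norm[OF f])
  qed
  also have "\<dots> = c * emeasure lborel A"
    by (simp add: nn_integral_cmult c_def mult.commute)
  finally show "emeasure (distr lborel borel f) A = emeasure lborel A"
    using c by (simp add: ennreal_mult_cancel_left)
qed simp

lemma space_sphere_measure [simp]: "space sphere_measure = UNIV"
  by (simp add: sphere_measure_def)

lemma sets_sphere_measure [simp, measurable_cong]: "sets sphere_measure = sets borel"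
  by (simp add: sphere_measure_def)

lemma measurable_normalize [measurable]:
  "(\<lambda>x :: real ^ 'n. x /\<^sub>R norm x) \<in> borel_measurable borel"
  by measurable

lemma emeasure_sphere_measure:
  fixes A :: "(real ^ 'n) set"
  assumes [measurable]: "A \<in> sets borel"
  shows "emeasure sphere_measure A =
    ennreal (real CARD('n)) * emeasure lborel {x \<in> ball 0 1 - {0}. x /\<^sub>R norm x \<in> A}"
proof -
  let ?B = "ball (0 :: real ^ 'n) 1 - {0}"
  have [measurable]: "(\<lambda>x :: real ^ 'n. x /\<^sub>R norm x) \<in> measurable (restrict_space lborel ?B) borel"
    by (rule measurable_restrict_space1) measurable
  have "emeasure sphere_measure A =
      (\<integral>\<^sup>+x. ennreal (real CARD('n)) * indicator A x
         \<partial>distr (restrict_space lborel ?B) borel (\<lambda>x. x /\<^sub>R norm x))"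
    unfolding sphere_measure_def by (subst emeasure_density) auto
  also have "\<dots> = ennreal (real CARD('n)) *
      emeasure (restrict_space lborel ?B) ((\<lambda>x. x /\<^sub>R norm x) -` A \<inter> ?B)"
    by (simp add: nn_integral_cmult emeasure_distr space_restrict_space)
  also have "emeasure (restrict_space lborel ?B) ((\<lambda>x. x /\<^sub>R norm x) -` A \<inter> ?B)
      = emeasure lborel {x \<in> ?B. x /\<^sub>R norm x \<in> A}"
    by (subst emeasure_restrict_space) (auto intro!: arg_cong[where f = "emeasure lborel"])
  finally show ?thesis .
qed

text \<open>The origin is a null set, so the mass is n times the volume of the unit ball; Gamma(n/2
  + 1) = (n/2) Gamma(n/2) turns this into \<open>omega (n - 1)\<close>.\<close>

lemma emeasure_sphere_measure_UNIV:
  "emeasure (sphere_measure :: (real ^ 'n) measure) UNIV = ennreal (omega (CARD('n) - 1))"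
proof -
  define n where "n = real CARD('n)"
  have n: "n > 0" by (simp add: n_def)
  have "emeasure lborel {x :: real ^ 'n \<in> ball 0 1 - {0}. x /\<^sub>R norm x \<in> UNIV}
      = emeasure lborel (ball (0 :: real ^ 'n) 1)"
    using emeasure_Diff_null_set[of "{0 :: real ^ 'n}" lborel "ball 0 1"] by (simp add: set_diff_eq null_sets_def)
  then have "emeasure (sphere_measure :: (real ^ 'n) measure) UNIV = ennreal (n * unit_ball_vol n)"
    by (simp add: emeasure_sphere_measure emeasure_ball n_def ennreal_mult)
  also have "n * unit_ball_vol n = omega (CARD('n) - 1)"
  proof -
    have "Gamma (n / 2 + 1) = n / 2 * Gamma (n / 2)"
      using n by (intro Gamma_plus1) (auto elim!: nonpos_Ints_cases)
    moreover have "real (CARD('n) - 1) = n - 1" by (simp add: n_def of_nat_diff Suc_leI)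
    ultimately show ?thesis using n by (simp only: omega_def unit_ball_vol_def) (simp add: divide_simps)
  qed
  finally show ?thesis .
qed

lemma finite_sphere_measure: "finite_measure (sphere_measure :: (real ^ 'n) measure)"
  by standard (simp add: emeasure_sphere_measure_UNIV)

text \<open>\<open>sphere_measure\<close> lives on the whole space; facts about unit vectors enter
  later integrals through this statement.\<close>

lemma AE_sphere_measure: "AE x in (sphere_measure :: (real ^ 'n) measure). norm x = 1"
proof (rule AE_I[where N = "{x. norm x \<noteq> 1}"])
  have "{x :: real ^ 'n \<in> ball 0 1 - {0}. x /\<^sub>R norm x \<in> {x. norm x \<noteq> 1}} = {}"
  proof -
    have "norm (x /\<^sub>R norm x) = 1" if "x \<noteq> 0" for x :: "real ^ 'n"
      using that by simp
    then show ?thesis by blast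
  qed
  then show "emeasure (sphere_measure :: (real ^ 'n) measure) {x. norm x \<noteq> 1} = 0"
    by (subst emeasure_sphere_measure) (measurable, simp only: emeasure_empty mult_zero_right)
qed auto

lemma distr_sphere_measure_orthogonal:
  fixes f :: "real ^ 'n \<Rightarrow> real ^ 'n"
  assumes f: "orthogonal_transformation f"
  shows "distr sphere_measure borel f = sphere_measure"
proof (rule measure_eqI)
  have lin: "linear f" by (rule orthogonal_transformation_linear[OF f])
  have [measurable]: "f \<in> borel_measurable borel"
    by (intro borel_measurable_continuous_onI linear_continuous_on linear_conv_bounded_linear[THEN iffD1] lin)
  fix A assume "A \<in> sets (distr sphere_measure borel f)"
  then have [measurable]: "A \<in> sets borel" by simp
  \<comment> \<open>An orthogonal map preserves the punctured ball and commutes with normalisation,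
    so invariance is inherited from Lebesgue measure.\<close>
  have eq: "f -` {x \<in> ball 0 1 - {0}. x /\<^sub>R norm x \<in> A} = {x \<in> ball 0 1 - {0}. x /\<^sub>R norm x \<in> f -` A}"
    using orthogonal_transformation_norm[OF f] linear_scale[OF lin]
    by (auto simp: linear_0[OF lin]) (metis norm_eq_zero)+
  have "emeasure lborel {x \<in> ball 0 1 - {0}. x /\<^sub>R norm x \<in> A}
      = emeasure (distr lborel borel f) {x \<in> ball 0 1 - {0}. x /\<^sub>R norm x \<in> A}"
    by (simp add: lborel_distr_orthogonal[OF f])
  also have "\<dots> = emeasure lborel {x \<in> ball 0 1 - {0}. x /\<^sub>R norm x \<in> f -` A}"
    by (subst emeasure_distr) (simp_all only: eq, auto)
  finally show "emeasure (distr sphere_measure borel f) A = emeasure sphere_measure A"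
    using measurable_sets[of f borel borel A]
    by (subst emeasure_distr) (auto simp: emeasure_sphere_measure)
qed simp

lemma integral_sphere_measure_orthogonal:
  fixes h :: "real ^ 'n \<Rightarrow> real" and f :: "real ^ 'n \<Rightarrow> real ^ 'n"
  assumes f: "orthogonal_transformation f" and [measurable]: "h \<in> borel_measurable borel"
  shows "(\<integral>x. h (f x) \<partial>sphere_measure) = (\<integral>x. h x \<partial>sphere_measure)"
proof -
  have [measurable]: "f \<in> borel_measurable borel"
    using f by (intro borel_measurable_continuous_onI linear_continuous_on
      linear_conv_bounded_linear[THEN iffD1] orthogonal_transformation_linear)
  show ?thesis
    by (subst (2) distr_sphere_measure_orthogonal[OF f, symmetric]) (simp add: integral_distr)
qed

lemma integrable_sphere_measure:
  fixes h :: "real ^ 'n \<Rightarrow> real"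
  assumes h: "continuous_on UNIV h"
  shows "integrable sphere_measure h"
proof -
  interpret finite_measure "sphere_measure :: (real ^ 'n) measure" by (rule finite_sphere_measure)
  have "bounded (h ` sphere 0 1)"
    by (intro compact_imp_bounded compact_continuous_image continuous_on_subset[OF h]) auto
  then obtain B where "\<And>x. norm x = 1 \<Longrightarrow> norm (h x) \<le> B"
    by (force simp: bounded_iff)
  then have "AE x in sphere_measure. norm (h x) \<le> B"
    using AE_sphere_measure by (auto elim: eventually_mono)
  moreover have "h \<in> borel_measurable sphere_measure"
    using borel_measurable_continuous_onI[OF h] by simp
  ultimately show ?thesis by (rule integrable_const_bound)
qed

text \<open>Any two unit vectors are related by an orthogonal map, which preserves the measure; the
  general case follows by homogeneity.\<close>

lemma integral_inner_power_norm:
  fixes u v :: "real ^ 'n"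
  assumes u: "norm u = 1"
  shows "(\<integral>x. (v \<bullet> x) ^ N \<partial>sphere_measure) = norm v ^ N * (\<integral>x. (u \<bullet> x) ^ N \<partial>sphere_measure)"
proof -
  have unit: "(\<integral>x. (w \<bullet> x) ^ N \<partial>sphere_measure) = (\<integral>x. (u \<bullet> x) ^ N \<partial>sphere_measure)"
    if "norm w = 1" for w :: "real ^ 'n"
  proof -
    obtain f where f: "orthogonal_transformation f" "f u = w"
      using orthogonal_transformation_exists_1[OF u \<open>norm w = 1\<close>] by blast
    have "(w \<bullet> f x) = u \<bullet> x" for x
      using f by (auto simp: orthogonal_transformation_def)
    then show ?thesis
      using integral_sphere_measure_orthogonal[OF f(1), of "\<lambda>x. (w \<bullet> x) ^ N"] by simp
  qed
  show ?thesis
  proof (cases "v = 0")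
    case True
    \<comment> \<open>For N = 0 both powers of 0 are 1.\<close>
    then show ?thesis by (cases "N = 0") (auto simp: power_0_left)
  next
    case False
    have "v \<bullet> x = norm v * ((v /\<^sub>R norm v) \<bullet> x)" for x
      using False by simp
    then have "(\<integral>x. (v \<bullet> x) ^ N \<partial>sphere_measure)
        = (\<integral>x. norm v ^ N * ((v /\<^sub>R norm v) \<bullet> x) ^ N \<partial>sphere_measure)"
      by (metis power_mult_distrib)
    then show ?thesis using unit[of "v /\<^sub>R norm v"] False by simp
  qed
qed

section \<open>Mixed moments on the sphere\<close>

text \<open>The generating polynomial of the mixed moments when u and v are orthogonal.\<close>

lemma coeff_one_plus_square_power:
  "coeff ([:1, 0, 1 :: real:] ^ K) 0 = 1 \<and> coeff ([:1, 0, 1 :: real:] ^ K) (Suc 0) = 0 \<and>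
   coeff ([:1, 0, 1 :: real:] ^ K) 2 = real K"
  by (induction K) (auto simp: coeff_pCons numeral_2_eq_2 split: nat.splits)

text \<open>The antipodal map preserves the measure and changes the sign of the integrand.\<close>

lemma sphere_moment_odd:
  fixes u v :: "real ^ 'n"
  assumes "odd (m + l)"
  shows "(\<integral>x. (u \<bullet> x) ^ m * (v \<bullet> x) ^ l \<partial>sphere_measure) = 0"
proof -
  have o: "orthogonal_transformation (uminus :: real ^ 'n \<Rightarrow> real ^ 'n)"
    by (auto simp: orthogonal_transformation_def linear_iff)
  have "(\<integral>x. (u \<bullet> x) ^ m * (v \<bullet> x) ^ l \<partial>sphere_measure)
     = (\<integral>x. (u \<bullet> - x) ^ m * (v \<bullet> - x) ^ l \<partial>sphere_measure)"
    by (rule integral_sphere_measure_orthogonal[OF o, symmetric]) measurable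
  also have "\<dots> = (\<integral>x. - ((u \<bullet> x) ^ m * (v \<bullet> x) ^ l) \<partial>sphere_measure)"
  proof (rule Bochner_Integration.integral_cong)
    fix x
    have "(u \<bullet> - x) ^ m * (v \<bullet> - x) ^ l = (-1) ^ (m + l) * ((u \<bullet> x) ^ m * (v \<bullet> x) ^ l)"
      unfolding inner_minus_right power_minus[of "u \<bullet> x"] power_minus[of "v \<bullet> x"] power_add by simp
    then show "(u \<bullet> - x) ^ m * (v \<bullet> - x) ^ l = - ((u \<bullet> x) ^ m * (v \<bullet> x) ^ l)"
      using assms by simp
  qed simp
  finally show ?thesis by simp
qed

text \<open>Evaluated at a, both sides are the integral of ((a u + v) . x)^(2K): once by the
  binomial theorem, once by rotation invariance with |a u + v|^2 = 1 + 2 (u . v) a + a^2. The even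
  exponent makes the power of the norm a polynomial in a.\<close>

lemma sphere_moment_gen_poly:
  fixes u v :: "real ^ 'n"
  assumes "norm u = 1" "norm v = 1"
  shows "(\<Sum>m\<le>2 * K. monom (real (2 * K choose m) *
            (\<integral>x. (u \<bullet> x) ^ m * (v \<bullet> x) ^ (2 * K - m) \<partial>sphere_measure)) m)
     = smult (\<integral>x. (u \<bullet> x) ^ (2 * K) \<partial>sphere_measure) ([:1, 2 * (u \<bullet> v), 1:] ^ K)"
    (is "?p = ?q")
proof -
  have "poly ?p a = poly ?q a" for a
  proof -
    have int: "integrable sphere_measure (\<lambda>x. (u \<bullet> x) ^ m * (v \<bullet> x) ^ l)" for m l
      by (intro integrable_sphere_measure continuous_intros)
    have "poly ?p a = (\<Sum>m\<le>2 * K. \<integral>x. real (2 * K choose m) * a ^ m *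
            ((u \<bullet> x) ^ m * (v \<bullet> x) ^ (2 * K - m)) \<partial>sphere_measure)"
      unfolding integral_mult_right_zero by (simp add: poly_sum poly_monom mult_ac)
    also have "\<dots> = (\<integral>x. (\<Sum>m\<le>2 * K. real (2 * K choose m) * a ^ m *
            ((u \<bullet> x) ^ m * (v \<bullet> x) ^ (2 * K - m))) \<partial>sphere_measure)"
      by (rule Bochner_Integration.integral_sum[symmetric]) (intro integrable_mult_right int)
    also have "\<dots> = (\<integral>x. ((a *\<^sub>R u + v) \<bullet> x) ^ (2 * K) \<partial>sphere_measure)"
      by (simp add: inner_add_left binomial_ring power_mult_distrib mult_ac)
    also have "\<dots> = norm (a *\<^sub>R u + v) ^ (2 * K) * (\<integral>x. (u \<bullet> x) ^ (2 * K) \<partial>sphere_measure)"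
      by (rule integral_inner_power_norm[OF assms(1)])
    also have "norm (a *\<^sub>R u + v) ^ (2 * K) = (1 + 2 * (u \<bullet> v) * a + a\<^sup>2) ^ K"
      using assms unfolding power_mult power2_norm_eq_inner
      by (simp add: inner_add_left inner_add_right inner_commute norm_eq_1 power2_eq_square algebra_simps)
    finally show ?thesis
      by (simp add: poly_power algebra_simps power2_eq_square)
  qed
  then show ?thesis by (simp add: poly_eq_poly_eq_iff[symmetric] fun_eq_iff)
qed

lemma sphere_moment_coeff:
  fixes u v :: "real ^ 'n"
  assumes "norm u = 1" "norm v = 1"
  shows "real (2 * K choose m) * (\<integral>x. (u \<bullet> x) ^ m * (v \<bullet> x) ^ (2 * K - m) \<partial>sphere_measure)
     = (\<integral>x. (u \<bullet> x) ^ (2 * K) \<partial>sphere_measure) * coeff ([:1, 2 * (u \<bullet> v), 1:] ^ K) m"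
  using arg_cong[OF sphere_moment_gen_poly[OF assms, of K], of "\<lambda>p. coeff p m"]
  by (cases "m \<le> 2 * K") (simp_all add: coeff_sum binomial_eq_0)

text \<open>By invariance u may be a coordinate vector e. Insert the sum of all x_j^2, which is 1 on
  the sphere, into the N-th moment: the direction of e contributes \<kappa>, each of the other
  directions \<kappa> / (N + 1).\<close>

lemma sphere_moment_Suc_Suc:
  fixes u :: "real ^ 'n"
  assumes "norm u = 1"
  shows "real (N + CARD('n)) * (\<integral>x. (u \<bullet> x) ^ (N + 2) \<partial>sphere_measure)
     = real (N + 1) * (\<integral>x. (u \<bullet> x) ^ N \<partial>sphere_measure)"
proof (cases "even N")
  case False
  then show ?thesis
    using sphere_moment_odd[of "N + 2" 0 u 0] sphere_moment_odd[of N 0 u 0] by simp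
next
  case True
  then obtain K where N: "N = 2 * K" by (elim evenE)
  define \<kappa> where "\<kappa> = (\<integral>x. (u \<bullet> x) ^ (N + 2) \<partial>sphere_measure)"
  have unit: "(\<integral>x. (w \<bullet> x) ^ j \<partial>sphere_measure) = (\<integral>x. (u \<bullet> x) ^ j \<partial>sphere_measure)"
    if "norm w = 1" for w :: "real ^ 'n" and j
    using integral_inner_power_norm[OF assms, of w j] that by simp
  fix i :: 'n
  define e where "e = (axis i 1 :: real ^ 'n)"
  have e: "norm e = 1" by (simp add: e_def)
  define T where "T j = (\<integral>x. (axis j 1 \<bullet> x) ^ 2 * (e \<bullet> x) ^ N \<partial>sphere_measure)" for j
  have T: "real (N + 1) * T j = \<kappa>" if "j \<noteq> i" for j
  proof -
    have "axis j 1 \<bullet> e = 0" using that by (simp add: e_def inner_axis_axis)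
    \<comment> \<open>The coefficient of a^2 in the generating polynomial of two orthogonal
      axes.\<close>
    then have "real (2 * (K + 1) choose 2) * T j = \<kappa> * real (K + 1)"
      using sphere_moment_coeff[of "axis j 1" e "K + 1" 2] e unit[of "axis j 1" "2 * K + 2"]
        coeff_one_plus_square_power[of "K + 1"]
      by (simp add: T_def N \<kappa>_def)
    moreover have "2 * (K + 1) choose 2 = (K + 1) * (2 * K + 1)"
      by (simp add: choose_two)
    ultimately have "real (K + 1) * (real (N + 1) * T j) = real (K + 1) * \<kappa>"
      by (simp add: N algebra_simps)
    then show ?thesis by (subst (asm) mult_cancel_left) auto
  qed
  have Ti: "T i = \<kappa>"
    using unit[OF e, of "N + 2"] by (simp add: T_def e_def[symmetric] \<kappa>_def power_add power2_eq_square mult_ac)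
  have "(\<integral>x. (u \<bullet> x) ^ N \<partial>sphere_measure) = (\<integral>x. (e \<bullet> x) ^ N \<partial>sphere_measure)"
    using unit[OF e] by simp
  also have "\<dots> = (\<integral>x. (\<Sum>j\<in>UNIV. (axis j 1 \<bullet> x) ^ 2 * (e \<bullet> x) ^ N) \<partial>sphere_measure)"
  proof (rule integral_cong_AE)
    show "AE x in sphere_measure. (e \<bullet> x) ^ N = (\<Sum>j\<in>UNIV. (axis j 1 \<bullet> x) ^ 2 * (e \<bullet> x) ^ N)"
      using AE_sphere_measure
    proof eventually_elim
      case (elim x)
      have "(\<Sum>j\<in>UNIV. (axis j 1 \<bullet> x) ^ 2) = 1"
        using elim by (simp add: inner_axis') (simp add: norm_eq_1 inner_vec_def power2_eq_square)
      then show ?case by (simp flip: sum_distrib_right)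
    qed
  qed measurable
  also have "\<dots> = (\<Sum>j\<in>UNIV. T j)"
    unfolding T_def
    by (rule Bochner_Integration.integral_sum) (intro integrable_sphere_measure continuous_intros)
  also have "\<dots> = T i + (\<Sum>j\<in>UNIV - {i}. T j)"
    by (simp add: sum.remove)
  finally have "real (N + 1) * (\<integral>x. (u \<bullet> x) ^ N \<partial>sphere_measure)
      = real (N + 1) * \<kappa> + (\<Sum>j\<in>UNIV - {i}. real (N + 1) * T j)"
    by (simp add: Ti distrib_left sum_distrib_left)
  also have "(\<Sum>j\<in>UNIV - {i}. real (N + 1) * T j) = (real CARD('n) - 1) * \<kappa>"
    using T by (simp add: card_Diff_singleton of_nat_diff Suc_leI)
  finally show ?thesis by (simp add: \<kappa>_def algebra_simps)
qed

text \<open>Integration by parts on the sphere in the tangential direction of u, obtained by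
  comparing coefficients in the derivative of Q^(K+1). For m + l even, each term has a moment of odd
  degree or a zero factor.\<close>

lemma sphere_moment_Suc:
  fixes u v :: "real ^ 'n"
  assumes uv: "norm u = 1" "norm v = 1"
  defines "M \<equiv> \<lambda>m l. \<integral>x. (u \<bullet> x) ^ m * (v \<bullet> x) ^ l \<partial>sphere_measure"
  shows "(real (m + l + CARD('n)) - 1) * M (Suc m) l
     = real m * M (m - 1) l + (u \<bullet> v) * real l * M m (l - 1)"
proof (cases "even (m + l)")
  case True
  have "M (Suc m) l = 0" using True unfolding M_def by (intro sphere_moment_odd) simp
  moreover have "real m * M (m - 1) l = 0"
    using True unfolding M_def by (cases m) (auto intro!: sphere_moment_odd)
  moreover have "real l * M m (l - 1) = 0"
    using True unfolding M_def by (cases l) (auto intro!: sphere_moment_odd)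
  ultimately show ?thesis by (simp only: mult.assoc mult_zero_right add_0)
next
  case False
  then obtain K where K: "m + l = 2 * K + 1" by (elim oddE)
  define s where "s = u \<bullet> v"
  define Q where "Q = [:1, 2 * s, 1:]"
  define \<kappa> where "\<kappa> j = (\<integral>x. (u \<bullet> x) ^ j \<partial>sphere_measure)" for j
  have coeff: "\<kappa> (2 * K) * coeff (Q ^ K) j = real (2 * K choose j) * M j (2 * K - j)"
     "\<kappa> (2 * K + 2) * coeff (Q ^ (K + 1)) j = real (2 * K + 2 choose j) * M j (2 * K + 2 - j)" for K j
    using sphere_moment_coeff[OF uv, of K j] sphere_moment_coeff[OF uv, of "K + 1" j]
    by (simp_all add: \<kappa>_def M_def Q_def s_def)
  have rec: "real (2 * K + CARD('n)) * \<kappa> (2 * K + 2) = real (2 * K + 1) * \<kappa> (2 * K)"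
    unfolding \<kappa>_def by (rule sphere_moment_Suc_Suc[OF uv(1)])
  \<comment> \<open>Since Q' = 2 (s + X), differentiation links the coefficients of Q^(K+1), of
    moment degree 2K + 2, to those of Q^K.\<close>
  have "pderiv (Q ^ (K + 1)) = smult (2 * real (K + 1)) ([:s, 1:] * Q ^ K)"
    by (simp add: pderiv_power_Suc Q_def pderiv_pCons smult_add_right algebra_simps
         del: power_Suc of_nat_Suc)
  then have der: "real (Suc m) * coeff (Q ^ (K + 1)) (Suc m)
      = 2 * real (K + 1) * (s * coeff (Q ^ K) m + (if m = 0 then 0 else coeff (Q ^ K) (m - 1)))"
    using coeff_pderiv[of "Q ^ (K + 1)" m] by (simp add: coeff_pCons split: nat.splits)
  \<comment> \<open>The three binomial coefficients involved are rational multiples of C, which is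
    cancelled at the end.\<close>
  define C where "C = real (2 * K + 1 choose m)"
  have C0: "C > 0" using K by (simp add: C_def)
  have C1: "real (Suc m) * real (2 * K + 2 choose Suc m) = real (2 * K + 2) * C"
    using arg_cong[OF Suc_times_binomial[of m "2 * K + 1"], of real] unfolding C_def of_nat_mult
    by simp
  have C2: "real (2 * K + 1) * real (2 * K choose m) = real l * C"
  proof (cases "l = 0")
    case True
    then show ?thesis using K by (simp add: binomial_eq_0)
  next
    case False
    have "(2 * K + 1) * (2 * K choose m) = (2 * K + 1 - m) * (2 * K + 1 choose m)"
      using binomial_absorb_comp[of "2 * K + 1" m] by simp
    moreover have "2 * K + 1 - m = l" using K by simp
    ultimately show ?thesis unfolding C_def of_nat_mult[symmetric] by simp
  qed
  have C3: "real (2 * K + 1) * (if m = 0 then 0 else real (2 * K choose (m - 1))) = real m * C"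
    using Suc_times_binomial[of "m - 1" "2 * K"] unfolding C_def
    by (cases m) (simp_all add: algebra_simps flip: of_nat_mult of_nat_add of_nat_Suc)
  have l: "2 * K + 2 - Suc m = l" "l \<noteq> 0 \<Longrightarrow> 2 * K - m = l - 1" "m \<noteq> 0 \<Longrightarrow> 2 * K - (m - 1) = l"
    using K by auto
  define B where "B = (if m = 0 then 0 else coeff (Q ^ K) (m - 1))"
  have "real (2 * K + 1) * (\<kappa> (2 * K) * coeff (Q ^ K) m) = real l * C * M m (l - 1)"
    using coeff(1)[of K m] C2 l(2) by (cases "l = 0") (auto simp: mult.assoc[symmetric])
  moreover have "real (2 * K + 1) * (\<kappa> (2 * K) * B) = real m * C * M (m - 1) l"
    using coeff(1)[of K "m - 1"] C3 l(3) by (cases "m = 0") (auto simp: B_def mult.assoc[symmetric])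
  moreover have "real (2 * K + 2) * C * real (2 * K + CARD('n)) * M (Suc m) l
      = real (2 * K + CARD('n)) * \<kappa> (2 * K + 2) * (real (Suc m) * coeff (Q ^ (K + 1)) (Suc m))"
    using coeff(2)[of K "Suc m"] C1 unfolding l by (simp add: mult_ac del: of_nat_Suc of_nat_add power_Suc)
  moreover have "\<dots> = real (2 * K + 2) * (s * (real (2 * K + 1) * (\<kappa> (2 * K) * coeff (Q ^ K) m))
      + real (2 * K + 1) * (\<kappa> (2 * K) * B))"
    unfolding der rec B_def[symmetric] by (simp add: algebra_simps)
  ultimately have "real (2 * K + 2) * C * real (2 * K + CARD('n)) * M (Suc m) l
     = real (2 * K + 2) * (s * (real l * C * M m (l - 1)) + real m * C * M (m - 1) l)"
    by (simp only:)
  then have "real (2 * K + 2) * C * (real (2 * K + CARD('n)) * M (Suc m) l)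
     = real (2 * K + 2) * C * (s * real l * M m (l - 1) + real m * M (m - 1) l)"
    by (simp only: distrib_left mult_ac)
  then have "real (2 * K + CARD('n)) * M (Suc m) l = s * real l * M m (l - 1) + real m * M (m - 1) l"
    using C0 by simp
  moreover have "real (m + l + CARD('n)) - 1 = real (2 * K + CARD('n))" unfolding K by simp
  ultimately show ?thesis by (simp only: s_def add.commute)
qed

text \<open>The recurrence in u, and the one with u and v exchanged, produce the same cross term (u
  . v) m l M (m - 1) (l - 1). Subtracting them eliminates u . v.\<close>

lemma sphere_moment_self_adjoint:
  fixes u v :: "real ^ 'n"
  assumes uv: "norm u = 1" "norm v = 1" and d: "d = CARD('n) - 1"
  defines "M \<equiv> \<lambda>m l. \<integral>x. (u \<bullet> x) ^ m * (v \<bullet> x) ^ l \<partial>sphere_measure"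
  shows "real m * (real m - 1) * M (m - 2) l - eigenval d m * M m l
       = real l * (real l - 1) * M m (l - 2) - eigenval d l * M m l"
proof -
  have card: "real CARD('n) = real d + 1" using d by (simp add: of_nat_diff Suc_leI)
  have "real m * (real m + real l + real d - 1) * M m l
      = real m * (real m - 1) * M (m - 2) l + (u \<bullet> v) * real m * real l * M (m - 1) (l - 1)"
  proof (cases m)
    case (Suc i)
    have "(real i + (real l + real d)) * M (Suc i) l = real i * M (i - 1) l + (u \<bullet> v) * real l * M i (l - 1)"
      using sphere_moment_Suc[OF uv, of i l] by (simp add: M_def card add.assoc)
    then have "real m * ((real i + (real l + real d)) * M (Suc i) l)
        = real m * (real i * M (i - 1) l + (u \<bullet> v) * real l * M i (l - 1))" by simp
    then show ?thesis by (simp add: Suc algebra_simps)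
  qed simp
  moreover have "real l * (real m + real l + real d - 1) * M m l
      = real l * (real l - 1) * M m (l - 2) + (u \<bullet> v) * real m * real l * M (m - 1) (l - 1)"
  proof (cases l)
    case (Suc i)
    have "(real i + (real m + real d)) * M m (Suc i) = real i * M m (i - 1) + (u \<bullet> v) * real m * M (m - 1) i"
      using sphere_moment_Suc[OF uv(2,1), of i m]
      by (simp add: M_def card add.assoc inner_commute[of v u] mult.commute[of "(u \<bullet> _) ^ _"])
    then have "real l * ((real i + (real m + real d)) * M m (Suc i))
        = real l * (real i * M m (i - 1) + (u \<bullet> v) * real m * M (m - 1) i)" by simp
    then show ?thesis by (simp add: Suc algebra_simps)
  qed simp
  ultimately show ?thesis
    unfolding eigenval_def by (simp add: algebra_simps)
qed

text \<open>The symmetry of monomials, extended by linearity: L passes from q(v . x) to the power of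
  u . x.\<close>

lemma sphere_poly_moment_gegen_op:
  fixes u v :: "real ^ 'n"
  assumes uv: "norm u = 1" "norm v = 1" and d: "d = CARD('n) - 1"
  defines "a \<equiv> \<lambda>q m. \<integral>x. (u \<bullet> x) ^ m * poly q (v \<bullet> x) \<partial>sphere_measure"
  shows "a (gegen_op d q) m = real m * (real m - 1) * a q (m - 2) - eigenval d m * a q m"
proof -
  have int: "integrable sphere_measure (\<lambda>x. (u \<bullet> x) ^ m * poly q (v \<bullet> x))" for m q
    by (intro integrable_sphere_measure continuous_intros continuous_on_poly)
  have add: "a (p + q) m = a p m + a q m" for p q m
    unfolding a_def by (simp add: distrib_left int)
  have sub: "a (p - q) m = a p m - a q m" for p q m
    unfolding a_def by (simp add: right_diff_distrib int)
  have mon: "a (monom c l) m = c * (\<integral>x. (u \<bullet> x) ^ m * (v \<bullet> x) ^ l \<partial>sphere_measure)" for c l m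
    unfolding a_def by (simp add: poly_monom mult.left_commute)
  have monom: "a (gegen_op d (monom c l)) m
      = real m * (real m - 1) * a (monom c l) (m - 2) - eigenval d m * a (monom c l) m" for c l
    using sphere_moment_self_adjoint[OF uv d, of m l]
    unfolding gegen_op_monom sub mon by algebra
  have "a (gegen_op d (\<Sum>i\<in>S. monom (f i) i)) m
      = real m * (real m - 1) * a (\<Sum>i\<in>S. monom (f i) i) (m - 2) - eigenval d m * a (\<Sum>i\<in>S. monom (f i) i) m"
    if "finite S" for S :: "nat set" and f
    using that
  proof induction
    case empty
    then show ?case by (simp add: a_def gegen_op_def)
  next
    case (insert i S)
    then show ?case by (simp add: gegen_op_add add monom algebra_simps)
  qed
  from this[of "{..degree q}" "coeff q"] show ?thesis
    by (simp add: poly_as_sum_of_monoms)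
qed

section \<open>Zonal eigenfunctions\<close>

text \<open>Weierstrass approximation of g on [-1,1] by polynomials. The weights \<open>h1\<close>,
  \<open>h2\<close> may change sign, as in the argument at the pole, so the error is measured
  against the integrals of their absolute values.\<close>

lemma integral_eq_of_moments_eq:
  fixes h1 T1 :: "'a \<Rightarrow> real" and h2 T2 :: "'b \<Rightarrow> real"
  assumes h: "integrable N1 h1" "integrable N2 h2"
    and [measurable]: "T1 \<in> borel_measurable N1" "T2 \<in> borel_measurable N2"
    and T: "AE x in N1. T1 x \<in> {-1..1}" "AE x in N2. T2 x \<in> {-1..1}"
    and mom: "\<And>m. (\<integral>x. T1 x ^ m * h1 x \<partial>N1) = (\<integral>x. T2 x ^ m * h2 x \<partial>N2)"
    and g: "continuous_on UNIV g"
  shows "(\<integral>x. g (T1 x) * h1 x \<partial>N1) = (\<integral>x. g (T2 x) * h2 x \<partial>N2)"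
proof -
  have [measurable]: "h1 \<in> borel_measurable N1" "h2 \<in> borel_measurable N2"
    using h by auto
  define I where "I = (\<integral>x. \<bar>h1 x\<bar> \<partial>N1) + (\<integral>x. \<bar>h2 x\<bar> \<partial>N2)"
  have [measurable]: "g \<in> borel_measurable borel" using g by (rule borel_measurable_continuous_onI)
  have int: "integrable N (\<lambda>x. f (T x) * h x)"
    if "integrable N h" "T \<in> borel_measurable N" "AE x in N. T x \<in> {-1..1}" "continuous_on UNIV f"
    for N :: "'c measure" and h T :: "'c \<Rightarrow> real" and f :: "real \<Rightarrow> real"
  proof -
    note [measurable] = that(2) borel_measurable_continuous_onI[OF that(4)]
    have "bounded (f ` {-1..1})"
      by (intro compact_imp_bounded compact_continuous_image continuous_on_subset[OF that(4)]) auto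
    then obtain B where B: "\<And>t. t \<in> {-1..1} \<Longrightarrow> \<bar>f t\<bar> \<le> B" by (force simp: bounded_iff)
    show ?thesis
    proof (rule Bochner_Integration.integrable_bound)
      show "integrable N (\<lambda>x. B * h x)" using that by simp
      show "AE x in N. norm (f (T x) * h x) \<le> norm (B * h x)"
        using that(3)
      proof eventually_elim
        case (elim x)
        from B[OF this] show ?case by (simp add: abs_mult mult_right_mono)
      qed
    qed (use that in measurable)
  qed
  have approx: "\<bar>(\<integral>x. g (T x) * h x \<partial>N) - (\<integral>x. p (T x) * h x \<partial>N)\<bar> \<le> e * (\<integral>x. \<bar>h x\<bar> \<partial>N)"
    if "integrable N h" "T \<in> borel_measurable N" "AE x in N. T x \<in> {-1..1}" "continuous_on UNIV p"
      and p: "\<And>t. t \<in> {-1..1} \<Longrightarrow> \<bar>g t - p t\<bar> < e"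
    for N :: "'c measure" and h T :: "'c \<Rightarrow> real" and p :: "real \<Rightarrow> real" and e
  proof -
    have "(\<integral>x. g (T x) * h x \<partial>N) - (\<integral>x. p (T x) * h x \<partial>N) = (\<integral>x. g (T x) * h x - p (T x) * h x \<partial>N)"
      by (intro Bochner_Integration.integral_diff[symmetric] int that g)
    also have "\<bar>\<dots>\<bar> \<le> (\<integral>x. \<bar>g (T x) * h x - p (T x) * h x\<bar> \<partial>N)"
      by (rule integral_abs_bound)
    also have "\<dots> \<le> (\<integral>x. e * \<bar>h x\<bar> \<partial>N)"
    proof (rule integral_mono_AE)
      show "integrable N (\<lambda>x. \<bar>g (T x) * h x - p (T x) * h x\<bar>)"
        by (intro integrable_abs Bochner_Integration.integrable_diff int that g)
      have "\<bar>g (T x) * h x - p (T x) * h x\<bar> \<le> e * \<bar>h x\<bar>" if "T x \<in> {-1..1}" for x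
        using p[OF that] by (simp add: abs_mult mult_right_mono flip: left_diff_distrib)
      then show "AE x in N. \<bar>g (T x) * h x - p (T x) * h x\<bar> \<le> e * \<bar>h x\<bar>"
        using that(3) by (auto elim: eventually_mono)
    qed (use that in simp)
    finally show ?thesis by simp
  qed
  have "\<bar>(\<integral>x. g (T1 x) * h1 x \<partial>N1) - (\<integral>x. g (T2 x) * h2 x \<partial>N2)\<bar> \<le> 0 + e" if "e > 0" for e
  proof -
    \<comment> \<open>Adding 1 to I avoids division by 0 and still gives e' I <= e.\<close>
    define e' where "e' = e / (I + 1)"
    have I: "I \<ge> 0" by (simp add: I_def)
    then have e': "e' > 0" using that by (simp add: e'_def)
    obtain p where p: "real_polynomial_function p" "\<And>t. t \<in> {-1..1} \<Longrightarrow> \<bar>g t - p t\<bar> < e'"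
      using Stone_Weierstrass_real_polynomial_function[of "{-1..1}" g e'] continuous_on_subset[OF g] e' by auto
    obtain c n where pc: "p = (\<lambda>t. \<Sum>i\<le>n. c i * t ^ i)"
      using p(1) by (auto simp: real_polynomial_function_iff_sum)
    have cp: "continuous_on UNIV p" unfolding pc by (intro continuous_intros)
    have sum: "(\<integral>x. p (T x) * h x \<partial>N) = (\<Sum>i\<le>n. c i * (\<integral>x. T x ^ i * h x \<partial>N))"
      if "integrable N h" "T \<in> borel_measurable N" "AE x in N. T x \<in> {-1..1}"
      for N :: "'c measure" and h T :: "'c \<Rightarrow> real"
    proof -
      have "(\<integral>x. p (T x) * h x \<partial>N) = (\<integral>x. (\<Sum>i\<le>n. c i * (T x ^ i * h x)) \<partial>N)"
        by (simp add: pc sum_distrib_right mult.assoc)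
      also have "\<dots> = (\<Sum>i\<le>n. \<integral>x. c i * (T x ^ i * h x) \<partial>N)"
        by (intro Bochner_Integration.integral_sum integrable_mult_right int[of _ _ _ "\<lambda>t. t ^ _"] that continuous_intros)
      finally show ?thesis by simp
    qed
    have "(\<integral>x. p (T1 x) * h1 x \<partial>N1) = (\<integral>x. p (T2 x) * h2 x \<partial>N2)"
      using sum[OF h(1) _ T(1)] sum[OF h(2) _ T(2)] by (simp add: mom)
    then have "\<bar>(\<integral>x. g (T1 x) * h1 x \<partial>N1) - (\<integral>x. g (T2 x) * h2 x \<partial>N2)\<bar> \<le> e' * I"
      using approx[OF h(1) _ T(1) cp p(2)] approx[OF h(2) _ T(2) cp p(2)]
      by (simp add: I_def distrib_left)
    also have "\<dots> \<le> e" using I that by (simp add: e'_def field_simps)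
    finally show ?thesis by simp
  qed
  then have "\<bar>(\<integral>x. g (T1 x) * h1 x \<partial>N1) - (\<integral>x. g (T2 x) * h2 x \<partial>N2)\<bar> \<le> 0"
    by (rule field_le_epsilon)
  then show ?thesis by simp
qed

text \<open>Equal moments give equal integrals of cos(t x) and sin(t x), hence equal characteristic
  functions.\<close>

lemma real_distribution_eqI_moments:
  assumes "prob_space N1" "prob_space N2" and sets: "sets N1 = sets borel" "sets N2 = sets borel"
    and AE: "AE x in N1. x \<in> {-1..1::real}" "AE x in N2. x \<in> {-1..1}"
    and mom: "\<And>m. (\<integral>x. x ^ m \<partial>N1) = (\<integral>x. x ^ m \<partial>N2)"
  shows "N1 = N2"
proof -
  interpret N1: prob_space N1 by fact
  interpret N2: prob_space N2 by fact
  have d: "real_distribution N1" "real_distribution N2"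
    using sets sets_eq_imp_space_eq[OF sets(1)] sets_eq_imp_space_eq[OF sets(2)]
    by (auto simp: real_distribution_def real_distribution_axioms_def N1.prob_space_axioms N2.prob_space_axioms)
  interpret N1: real_distribution N1 by (rule d)
  interpret N2: real_distribution N2 by (rule d)
  have eq: "(\<integral>x. g x \<partial>N1) = (\<integral>x. g x \<partial>N2)" if "continuous_on UNIV g" for g :: "real \<Rightarrow> real"
  proof -
    have "(\<integral>x. g x * 1 \<partial>N1) = (\<integral>x. g x * 1 \<partial>N2)"
    proof (rule integral_eq_of_moments_eq[OF _ _ _ _ AE _ that])
      show "(\<integral>x. x ^ m * 1 \<partial>N1) = (\<integral>x. x ^ m * 1 \<partial>N2)" for m
        using mom by simp
    qed simp_all
    then show ?thesis by simp
  qed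
  show ?thesis
  proof (rule Levy_uniqueness[OF d])
    show "char N1 = char N2"
    proof
      fix t
      have "Re (char N1 t) = Re (char N2 t)" "Im (char N1 t) = Im (char N2 t)"
        unfolding char_def
        by (simp_all add: integral_Re[symmetric] integral_Im[symmetric] N1.integrable_iexp N2.integrable_iexp Re_exp Im_exp)
          (intro eq continuous_intros)+
      then show "char N1 t = char N2 t" by (rule complex_eqI)
    qed
  qed
qed

text \<open>By density of polynomials, \<open>h\<close> integrates to \<open>0\<close> against a bump function of \<open>u \<bullet> x\<close>
  supported in a cap around \<open>u\<close> on which \<open>h\<close> would have constant sign.\<close>
lemma zonal_orthogonal_imp_zero_at_pole:
  fixes h :: "real ^ 'n \<Rightarrow> real"
  assumes u: "norm u = 1" and h: "continuous_on UNIV h"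
    and mom: "\<And>m. (\<integral>x. (u \<bullet> x) ^ m * h x \<partial>sphere_measure) = 0"
  shows "h u = 0"
proof -
  have inner_range: "u \<bullet> x \<in> {-1..1}" if "norm x = 1" for x
    using Cauchy_Schwarz_ineq2[of u x] u that by auto
  have False if h: "continuous_on UNIV h" and pos: "h u > 0"
    and mom: "\<And>m. (\<integral>x. (u \<bullet> x) ^ m * h x \<partial>sphere_measure) = 0" for h
  proof -
    have "open {x. h x > 0}"
      using open_Collect_less[OF continuous_on_const h] by simp
    then obtain \<delta> where \<delta>: "\<delta> > 0" "\<And>x. dist x u < \<delta> \<Longrightarrow> h x > 0"
      using pos unfolding open_dist by blast
    \<comment> \<open>On the sphere |x - u|^2 = 2 - 2 u . x, so u . x > c means that x is within
      distance \<delta> of u.\<close>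
    define c where "c = 1 - \<delta>\<^sup>2 / 2"
    have cap: "h x > 0" if "norm x = 1" "u \<bullet> x > c" for x
    proof (rule \<delta>)
      have "(dist x u)\<^sup>2 = 2 - 2 * (u \<bullet> x)"
        using u that(1) unfolding dist_norm power2_norm_eq_inner
        by (simp add: inner_diff_left inner_diff_right inner_commute norm_eq_1)
      also have "\<dots> < \<delta>\<^sup>2" using that(2) by (simp add: c_def)
      finally show "dist x u < \<delta>" using \<delta>(1) by (simp add: power_less_imp_less_base less_imp_le)
    qed
    define g where "g t = max 0 (t - c)" for t :: real
    have g: "continuous_on UNIV g" unfolding g_def by (intro continuous_intros)
    have "AE x in sphere_measure. u \<bullet> x \<in> {-1..1}"
      using AE_sphere_measure by eventually_elim (rule inner_range)
    then have "(\<integral>x. g (u \<bullet> x) * h x \<partial>sphere_measure) = (\<integral>x. g (u \<bullet> x) * 0 \<partial>sphere_measure)"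
      using mom
      by (intro integral_eq_of_moments_eq[OF integrable_sphere_measure[OF h] _ _ _ _ _ _ g]) auto
    then have "(\<integral>x. g (u \<bullet> x) * h x \<partial>sphere_measure) = 0" by simp
    moreover have "integrable sphere_measure (\<lambda>x. g (u \<bullet> x) * h x)"
      unfolding g_def by (intro integrable_sphere_measure continuous_intros h)
    moreover have "AE x in sphere_measure. 0 \<le> g (u \<bullet> x) * h x"
      using AE_sphere_measure
    proof eventually_elim
      case (elim x)
      then show ?case using cap[of x] by (cases "u \<bullet> x > c") (auto simp: g_def)
    qed
    ultimately have "AE x in sphere_measure. g (u \<bullet> x) * h x = 0"
      by (simp add: integral_nonneg_eq_0_iff_AE)
    then have "AE x in sphere_measure. \<not> u \<bullet> x > c"
      using AE_sphere_measure
    proof eventually_elim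
      case (elim x)
      then show ?case using cap[of x] by (auto simp: g_def)
    qed
    moreover have [measurable]: "{x. u \<bullet> x > c} \<in> sets borel" by measurable
    ultimately have "emeasure sphere_measure {x. u \<bullet> x > c} = 0"
      by (simp add: AE_iff_measurable[OF _ refl])
    then have "emeasure lborel {x \<in> ball 0 1 - {0}. x /\<^sub>R norm x \<in> {x. u \<bullet> x > c}} = 0"
      by (simp add: emeasure_sphere_measure)
    moreover have op: "open {x \<in> ball 0 1 - {0}. x /\<^sub>R norm x \<in> {x. u \<bullet> x > c}}" (is "open ?S")
    proof -
      have "open ((ball 0 1 - {0}) \<inter> (\<lambda>x. u \<bullet> (x /\<^sub>R norm x)) -` {c<..})"
        by (intro continuous_open_preimage continuous_intros open_Diff) auto
      moreover have "?S = (ball 0 1 - {0}) \<inter> (\<lambda>x. u \<bullet> (x /\<^sub>R norm x)) -` {c<..}" by auto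
      ultimately show ?thesis by simp
    qed
    ultimately have "negligible ?S"
      by (simp add: negligible_iff_null_sets null_sets_def borel_open emeasure_completion)
    \<comment> \<open>The cone over the cap is open and contains u / 2, so it cannot be a null
      set.\<close>
    moreover have "u /\<^sub>R 2 \<in> ?S"
      using u \<delta>(1) by (auto simp: c_def simp flip: power2_norm_eq_inner)
    ultimately show False using open_not_negligible[OF op] by blast
  qed
  from this[OF h _ mom] this[of "\<lambda>x. - h x"] show ?thesis
    using h mom by (cases "h u" "0 :: real" rule: linorder_cases) (auto intro!: continuous_intros)
qed

text \<open>A formula of Funk-Hecke type. The recurrence leaves one free parameter in the moments,
  namely \<open>b w\<close>; hence the sequences for v and u are proportional, and evaluation at the
  pole gives the ratio.\<close>

lemma zonal_eigen_moments:
  fixes u v :: "real ^ 'n"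
  assumes uv: "norm u = 1" "norm v = 1" and d: "d = CARD('n) - 1" "d \<ge> 1"
    and P: "P \<noteq> 0" "gegen_op d P = smult (- eigenval d k) P" "poly P 1 \<noteq> 0"
  shows "(\<integral>x. (u \<bullet> x) ^ m * poly P (v \<bullet> x) \<partial>sphere_measure)
    = poly P (u \<bullet> v) / poly P 1 * (\<integral>x. (u \<bullet> x) ^ m * poly P (u \<bullet> x) \<partial>sphere_measure)"
proof -
  define a where "a w m = (\<integral>x. (u \<bullet> x) ^ m * poly P (w \<bullet> x) \<partial>sphere_measure)" for w m
  define b where "b w = (\<integral>x. poly P (u \<bullet> x) * poly P (w \<bullet> x) \<partial>sphere_measure)" for w
  have int: "integrable sphere_measure (\<lambda>x. (u \<bullet> x) ^ m * poly P (w \<bullet> x))" for w m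
    by (intro integrable_sphere_measure continuous_intros continuous_on_poly)
  have rec: "real m * (real m - 1) * a w (m - 2) - eigenval d m * a w m = - eigenval d k * a w m"
    if "norm w = 1" for w m
    using sphere_poly_moment_gegen_op[OF uv(1) that d(1), where q = P and m = m] P(2) by (simp add: a_def mult.left_commute[of _ "eigenval d k"])
  have b_eq: "(\<Sum>l\<le>degree P. coeff P l * a w l) = b w" for w
  proof -
    have "b w = (\<integral>x. (\<Sum>l\<le>degree P. coeff P l * ((u \<bullet> x) ^ l * poly P (w \<bullet> x))) \<partial>sphere_measure)"
      unfolding b_def by (subst (1) poly_altdef) (simp add: sum_distrib_right mult.assoc)
    also have "\<dots> = (\<Sum>l\<le>degree P. \<integral>x. coeff P l * ((u \<bullet> x) ^ l * poly P (w \<bullet> x)) \<partial>sphere_measure)"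
      by (intro Bochner_Integration.integral_sum integrable_mult_right int)
    finally show ?thesis by (simp add: a_def)
  qed
  \<comment> \<open>Otherwise all moments of P(u . x) against powers of u . x vanish, which forces
    P(1) = 0 at the pole.\<close>
  have bu: "b u \<noteq> 0"
  proof
    assume "b u = 0"
    then have "a u m = 0" for m
      using moments_eq_0[OF d(2) P(1,2), of "a u"] rec[OF uv(1)] b_eq[of u] by simp
    then have "poly P (u \<bullet> u) = 0"
      unfolding a_def
      by (intro zonal_orthogonal_imp_zero_at_pole[OF uv(1), of "\<lambda>x. poly P (u \<bullet> x)"])
         (auto intro!: continuous_intros continuous_on_poly)
    then show False using P(3) uv(1) by (simp add: norm_eq_1)
  qed
  \<comment> \<open>This combination inherits the recurrence, and its contraction with the
    coefficients of P is b u b v - b v b u = 0.\<close>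
  have eq: "b u * a v m - b v * a u m = 0" for m
  proof (rule moments_eq_0[OF d(2) P(1,2)])
    fix m
    show "real m * (real m - 1) * (b u * a v (m - 2) - b v * a u (m - 2)) - eigenval d m * (b u * a v m - b v * a u m)
        = - eigenval d k * (b u * a v m - b v * a u m)"
      using rec[OF uv(1), of m] rec[OF uv(2), of m] by algebra
    have "(\<Sum>l\<le>degree P. coeff P l * (b u * a v l - b v * a u l))
        = b u * (\<Sum>l\<le>degree P. coeff P l * a v l) - b v * (\<Sum>l\<le>degree P. coeff P l * a u l)"
      by (simp add: right_diff_distrib sum_subtractf sum_distrib_left mult_ac)
    then show "(\<Sum>l\<le>degree P. coeff P l * (b u * a v l - b v * a u l)) = 0"
      by (simp add: b_eq)
  qed
  \<comment> \<open>The function here has all moments along u equal to 0, so it vanishes at x =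
    u.\<close>
  have "b u * poly P (v \<bullet> u) - b v * poly P (u \<bullet> u) = 0"
  proof (rule zonal_orthogonal_imp_zero_at_pole[OF uv(1), of "\<lambda>x. b u * poly P (v \<bullet> x) - b v * poly P (u \<bullet> x)"])
    fix m
    have "(\<integral>x. (u \<bullet> x) ^ m * (b u * poly P (v \<bullet> x) - b v * poly P (u \<bullet> x)) \<partial>sphere_measure)
        = (\<integral>x. b u * ((u \<bullet> x) ^ m * poly P (v \<bullet> x)) - b v * ((u \<bullet> x) ^ m * poly P (u \<bullet> x)) \<partial>sphere_measure)"
      by (simp add: algebra_simps)
    also have "\<dots> = b u * a v m - b v * a u m"
      unfolding a_def by (subst Bochner_Integration.integral_diff) (simp_all add: int)
    finally show "(\<integral>x. (u \<bullet> x) ^ m * (b u * poly P (v \<bullet> x) - b v * poly P (u \<bullet> x)) \<partial>sphere_measure) = 0"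
      by (simp add: eq)
  qed (intro continuous_intros continuous_on_poly)
  then have "b v = b u * poly P (u \<bullet> v) / poly P 1"
    using P(3) uv(1) by (simp add: norm_eq_1 inner_commute field_simps)
  then have "b u * a v m = b u * (poly P (u \<bullet> v) / poly P 1 * a u m)"
    using eq[of m] by simp
  then have "a v m = poly P (u \<bullet> v) / poly P 1 * a u m"
    using bu by (subst (asm) mult_left_cancel)
  then show ?thesis by (simp only: a_def)
qed

section \<open>The one-dimensional weight\<close>

lemma omega_pos: "omega m > 0"
  unfolding omega_def by (intro divide_pos_pos Gamma_real_pos) auto

lemma omega_Suc_Suc: "omega (m + 2) = 2 * pi / (real m + 1) * omega m"
proof -
  have "Gamma ((real m + 1) / 2 + 1) = (real m + 1) / 2 * Gamma ((real m + 1) / 2)"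
    by (intro Gamma_plus1) (auto elim!: nonpos_Ints_cases)
  moreover have "(real (m + 2) + 1) / 2 = (real m + 1) / 2 + 1" by (simp add: field_simps)
  moreover have "pi powr ((real m + 1) / 2 + 1) = pi powr ((real m + 1) / 2) * pi"
    by (simp add: powr_add)
  moreover have "Gamma ((real m + 1) / 2) > 0" by (rule Gamma_real_pos) simp
  ultimately show ?thesis unfolding omega_def by (simp only:) (simp add: divide_simps)
qed

abbreviation weight :: "nat \<Rightarrow> real \<Rightarrow> real" where
  "weight d t \<equiv> (1 - t\<^sup>2) powr (real d / 2 - 1)"

text \<open>The integrand is the derivative of p(t) (1 - t^2)^(d/2), whose boundary term at -1 is 0.
  The interior form of the fundamental theorem is used because differentiability is checked only
  where 1 - t^2 > 0.\<close>

lemma has_integral_poly_weight_derivative: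
  assumes "d \<ge> 1" "x \<in> {-1..1}"
  shows "((\<lambda>t. ((1 - t\<^sup>2) * poly (pderiv p) t - real d * t * poly p t) * weight d t)
     has_integral poly p x * (1 - x\<^sup>2) powr (real d / 2)) {-1..x}"
proof -
  have "((\<lambda>t. ((1 - t\<^sup>2) * poly (pderiv p) t - real d * t * poly p t) * weight d t)
     has_integral poly p x * (1 - x\<^sup>2) powr (real d / 2) - poly p (-1) * (1 - (-1)\<^sup>2) powr (real d / 2)) {-1..x}"
  proof (rule fundamental_theorem_of_calculus_interior)
    have "continuous_on {-1..x} (\<lambda>t. (1 - t\<^sup>2) powr (real d / 2))"
      using assms by (intro continuous_on_powr' continuous_intros) (auto simp: abs_square_le_1 abs_le_iff)
    then show "continuous_on {-1..x} (\<lambda>t. poly p t * (1 - t\<^sup>2) powr (real d / 2))"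
      by (intro continuous_on_mult continuous_on_poly continuous_on_id)
    fix t assume t: "t \<in> {-1<..<x}"
    then have pos: "1 - t\<^sup>2 > 0" using assms(2) by (auto simp: abs_square_less_1)
    then have eq: "(1 - t\<^sup>2) powr (real d / 2) = (1 - t\<^sup>2) * weight d t"
      using powr_add[of "1 - t\<^sup>2" 1 "real d / 2 - 1"] by simp
    have "((\<lambda>t. poly p t * (1 - t\<^sup>2) powr (real d / 2)) has_real_derivative
       poly (pderiv p) t * (1 - t\<^sup>2) powr (real d / 2) - real d * t * weight d t * poly p t) (at t)"
      using pos by (auto intro!: derivative_eq_intros)
    then show "((\<lambda>t. poly p t * (1 - t\<^sup>2) powr (real d / 2)) has_vector_derivative
       ((1 - t\<^sup>2) * poly (pderiv p) t - real d * t * poly p t) * weight d t) (at t)"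
      unfolding has_real_derivative_iff_has_vector_derivative[symmetric]
      unfolding eq by (simp add: algebra_simps)
  qed (use assms in auto)
  then show ?thesis by simp
qed

text \<open>Induction in steps of two from the arcsine (d = 1) and constant (d = 2) cases, parallel
  to the recurrence of \<open>omega\<close>.\<close>

lemma has_integral_weight:
  assumes "d \<ge> 1"
  shows "(weight d has_integral omega d / omega (d - 1)) {-1..1}"
  using assms
proof (induction d rule: less_induct)
  case (less d)
  consider "d = 1" | "d = 2" | e where "d = e + 2" "e \<ge> 1"
    using less.prems by (cases "d \<le> 2") (force, metis add.commute le_add_diff_inverse nat_le_linear not_less_eq_eq numeral_2_eq_2 add_le_imp_le_diff One_nat_def plus_1_eq_Suc)
  then show ?case
  proof cases
    case 1
    have "((\<lambda>t. inverse (sqrt (1 - t\<^sup>2))) has_integral arcsin 1 - arcsin (-1)) {-1..1}"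
    proof (rule fundamental_theorem_of_calculus_interior)
      fix t :: real assume "t \<in> {-1<..<1}"
      then show "(arcsin has_vector_derivative inverse (sqrt (1 - t\<^sup>2))) (at t)"
        unfolding has_real_derivative_iff_has_vector_derivative[symmetric]
        by (intro DERIV_arcsin) auto
    qed (auto intro: continuous_on_arcsin')
    \<comment> \<open>At the endpoints both sides are 0, as inverse 0 = 0 and 0 powr anything is
      0.\<close>
    moreover have "inverse (sqrt (1 - t\<^sup>2)) = weight d t" if "t \<in> {-1..1}" for t
      using that 1 by (simp add: powr_minus powr_half_sqrt abs_square_le_1 abs_le_iff)
    moreover have "omega d / omega (d - 1) = pi"
      using 1 by (simp add: omega_def Gamma_one_half_real powr_half_sqrt)
    ultimately show ?thesis
      using has_integral_eq[of "{-1..1}" "\<lambda>t. inverse (sqrt (1 - t\<^sup>2))" "weight d" pi] by simp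
  next
    case 2
    have "((\<lambda>t::real. 1::real) has_integral 2) {-1..1}"
      using has_integral_const_real[of "1::real" "-1" 1] by simp
    then have "(weight d has_integral 2) {-1..1}"
      \<comment> \<open>At -1 and 1 the weight is 0 powr 0 = 0 and not 1, hence the two exceptional
        points.\<close>
      by (rule has_integral_spike_finite[of "{-1,1}", rotated 2])
         (auto simp: 2 power2_eq_1_iff)
    moreover have "omega d / omega (d - 1) = 2"
      using omega_Suc_Suc[of 0] Gamma_fact[of 0, where 'a = real] by (simp add: 2 omega_def numeral_2_eq_2 Gamma_one_half_real powr_half_sqrt)
    ultimately show ?thesis by simp
  next
    case 3
    have IH: "(weight e has_integral omega e / omega (e - 1)) {-1..1}"
      using less.IH[of e] 3 by simp
    \<comment> \<open>The case p = t. As weight e (1 - t^2) is weight d, it says that e + 1 times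
      the integral for d equals e times the integral for e.\<close>
    have "((\<lambda>t. ((1 - t\<^sup>2) - real e * t * t) * weight e t) has_integral 0) {-1..1}"
      using has_integral_poly_weight_derivative[of e 1 "[:0, 1:]"] 3 by (simp add: pderiv_pCons)
    from has_integral_divide[OF has_integral_add[OF this has_integral_mult_right[OF IH, of "real e"]], of "real e + 1"]
    have "((\<lambda>t. (((1 - t\<^sup>2) - real e * t * t) * weight e t + real e * weight e t) / (real e + 1))
       has_integral real e * (omega e / omega (e - 1)) / (real e + 1)) {-1..1}" by simp
    moreover have "(((1 - t\<^sup>2) - real e * t * t) * weight e t + real e * weight e t) / (real e + 1) = weight d t"
      if "t \<in> {-1..1}" for t
    proof -
      have "(1 - t\<^sup>2) * weight e t = weight d t"
        using that powr_mult_base[of "1 - t\<^sup>2" "real e / 2 - 1"] 3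
        by (simp add: abs_square_le_1 abs_le_iff add_divide_distrib)
      moreover have "((1 - t\<^sup>2) - real e * t * t) * weight e t + real e * weight e t
          = (real e + 1) * ((1 - t\<^sup>2) * weight e t)"
        by (simp add: algebra_simps power2_eq_square)
      ultimately show ?thesis by simp
    qed
    moreover have "real e * (omega e / omega (e - 1)) / (real e + 1) = omega d / omega (d - 1)"
    proof -
      obtain i where i: "e = Suc i" using 3 by (cases e) auto
      have "omega (d - 1) = 2 * pi / real e * omega (e - 1)"
        using omega_Suc_Suc[of i] 3 i by (simp add: add.commute)
      moreover have "omega d = 2 * pi / (real e + 1) * omega e"
        using omega_Suc_Suc[of e] 3 by simp
      ultimately show ?thesis using 3 by (simp add: mult_ac)
    qed
    ultimately show ?thesis by (metis (no_types, lifting) has_integral_eq)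
  qed
qed

text \<open>For d = 1 the weight is unbounded. Its Lebesgue integrability follows from nonnegativity
  and the finite gauge integral; g is bounded on [-1,1].\<close>

lemma set_integrable_weight:
  assumes "d \<ge> 1" and g: "continuous_on UNIV g" and x: "x \<le> 1"
  shows "set_integrable lborel {-1..x} (\<lambda>t. g t * weight d t)"
proof -
  have nn: "(\<integral>\<^sup>+t. ennreal (indicator {-1..1} t * weight d t) \<partial>lborel) < \<infinity>"
    using nn_integral_has_integral_lebesgue[OF _ has_integral_weight[OF assms(1)]] by simp
  have w: "set_integrable lborel {-1..1} (weight d)"
    unfolding set_integrable_def real_scaleR_def
    by (rule integrableI_nonneg) (use nn in auto)
  have "bounded (g ` {-1..1})"
    by (intro compact_imp_bounded compact_continuous_image continuous_on_subset[OF g]) auto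
  then obtain B where B: "\<And>t. t \<in> {-1..1} \<Longrightarrow> \<bar>g t\<bar> \<le> B" by (force simp: bounded_iff)
  have [measurable]: "g \<in> borel_measurable borel" by (rule borel_measurable_continuous_onI[OF g])
  have "set_integrable lborel {-1..1} (\<lambda>t. B * weight d t)"
    using w by (rule set_integrable_mult_right)
  then have "set_integrable lborel {-1..1} (\<lambda>t. g t * weight d t)"
    by (rule set_integrable_bound)
       (auto simp: set_borel_measurable_def abs_mult intro!: mult_right_mono B order.trans[OF B abs_ge_self])
  then show ?thesis
    by (rule set_integrable_subset) (use x in auto)
qed

lemma set_integral_poly_weight_derivative:
  assumes "d \<ge> 1" "x \<in> {-1..1}"
  shows "(LINT t:{-1..x}|lborel. ((1 - t\<^sup>2) * poly (pderiv p) t - real d * t * poly p t) * weight d t)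
     = poly p x * (1 - x\<^sup>2) powr (real d / 2)"
proof -
  have "set_integrable lborel {-1..x} (\<lambda>t. ((1 - t\<^sup>2) * poly (pderiv p) t - real d * t * poly p t) * weight d t)"
    using assms by (intro set_integrable_weight continuous_intros continuous_on_poly) auto
  from set_borel_integral_eq_integral(2)[OF this] show ?thesis
    using integral_unique[OF has_integral_poly_weight_derivative[OF assms, of p]] by simp
qed

text \<open>With p = P' the integrand of the preceding lemma is L P times the weight, that is, a
  multiple of P times the weight.\<close>

lemma set_integral_gegen_d_poly_weight:
  assumes "d \<ge> 1" "k \<ge> 1" "x \<in> {-1..1}"
  shows "(LINT t:{-1..x}|lborel. poly (gegen_d_poly d k) t * weight d t) = - G d k x"
proof -
  let ?P = "gegen_d_poly d k"
  have lam: "eigenval d k > 0" using assms by (simp add: eigenval_def)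
  have "(1 - t\<^sup>2) * poly (pderiv (pderiv ?P)) t - real d * t * poly (pderiv ?P) t = - eigenval d k * poly ?P t" for t
    using arg_cong[OF gegen_op_gegen_d_poly[OF assms(1), of k], of "\<lambda>q. poly q t"] by (simp add: poly_gegen_op)
  then have "- eigenval d k * (LINT t:{-1..x}|lborel. poly ?P t * weight d t)
      = poly (pderiv ?P) x * (1 - x\<^sup>2) powr (real d / 2)"
    using set_integral_poly_weight_derivative[OF assms(1,3), of "pderiv ?P"]
    by (simp only: mult.assoc set_integral_mult_right)
  then show ?thesis using lam by (simp add: G_eq[OF assms] field_simps)
qed

text \<open>Both sides satisfy the same recurrence in steps of two, and they agree for N = 0 by the
  total area and for N = 1 by symmetry.\<close>

lemma sphere_moment_eq_weight_moment:
  fixes u :: "real ^ 'n"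
  assumes u: "norm u = 1" and d: "d = CARD('n) - 1" "d \<ge> 1"
  shows "(\<integral>x. (u \<bullet> x) ^ N \<partial>sphere_measure) = omega (d - 1) * (LINT t:{-1..1}|lborel. t ^ N * weight d t)"
proof (induction N rule: induct_nat_012)
  case 0
  have "measure (sphere_measure :: (real ^ 'n) measure) UNIV = omega d"
    using omega_pos[of d] by (simp add: measure_def emeasure_sphere_measure_UNIV d(1) less_imp_le)
  moreover have "(LINT t:{-1..1}|lborel. 1 * weight d t) = omega d / omega (d - 1)"
    using set_borel_integral_eq_integral(2)[OF set_integrable_weight[OF d(2), of "\<lambda>_. 1" 1]]
      integral_unique[OF has_integral_weight[OF d(2)]] by simp
  ultimately show ?case using omega_pos[of "d - 1"] by simp
next
  case 1
  have "(LINT t:{-1..1}|lborel. - real d * (t * weight d t)) = 0"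
    using set_integral_poly_weight_derivative[OF d(2), of 1 1] d(2) by (simp add: mult.assoc)
  then have "(LINT t:{-1..1}|lborel. t * weight d t) = 0"
    using d(2) by (simp only: set_integral_mult_right) simp
  then show ?case using sphere_moment_odd[of 1 0 u 0] by simp
next
  case (ge2 N)
  let ?W = "\<lambda>N. LINT t:{-1..1}|lborel. t ^ N * weight d t"
  have int: "set_integrable lborel {-1..1} (\<lambda>t. t ^ m * weight d t)" for m
    by (intro set_integrable_weight d continuous_intros) auto
  \<comment> \<open>With p = t^(N+1) the vanishing boundary terms give the recurrence of the weight
    moments.\<close>
  have "(LINT t:{-1..1}|lborel. ((1 - t\<^sup>2) * poly (pderiv (monom 1 (Suc N))) t - real d * t * poly (monom 1 (Suc N)) t) * weight d t) = 0"
    using set_integral_poly_weight_derivative[OF d(2), of 1 "monom 1 (Suc N)"] d(2) by simp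
  moreover have "((1 - t\<^sup>2) * poly (pderiv (monom 1 (Suc N))) t - real d * t * poly (monom 1 (Suc N)) t) * weight d t
      = real (Suc N) * (t ^ N * weight d t) - (real (Suc N) + real d) * (t ^ Suc (Suc N) * weight d t)" for t
    by (simp add: pderiv_monom poly_monom algebra_simps power2_eq_square del: of_nat_Suc)
  ultimately have "(LINT t:{-1..1}|lborel. real (Suc N) * (t ^ N * weight d t)
      - (real (Suc N) + real d) * (t ^ Suc (Suc N) * weight d t)) = 0"
    by (simp only:)
  then have "real (Suc N) * ?W N - (real (Suc N) + real d) * ?W (Suc (Suc N)) = 0"
    by (subst (asm) set_integral_diff(2)) (simp_all only: set_integrable_mult_right int set_integral_mult_right)
  then have "(real (Suc N) + real d) * ?W (Suc (Suc N)) = real (Suc N) * ?W N" by simp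
  moreover have "real (N + CARD('n)) = real (Suc N) + real d" using d by simp
  then have "(real (Suc N) + real d) * (\<integral>x. (u \<bullet> x) ^ Suc (Suc N) \<partial>sphere_measure)
      = real (Suc N) * (\<integral>x. (u \<bullet> x) ^ N \<partial>sphere_measure)"
    using sphere_moment_Suc_Suc[OF u, of N] by (simp add: add_ac)
  ultimately have "(real (Suc N) + real d) * (\<integral>x. (u \<bullet> x) ^ Suc (Suc N) \<partial>sphere_measure)
      = (real (Suc N) + real d) * (omega (d - 1) * ?W (Suc (Suc N)))"
    using ge2(1) by (simp only: mult.left_commute[of _ "omega (d - 1)"])
  then show ?case
    by (subst (asm) mult_left_cancel) (auto simp: add_eq_0_iff)
qed

lemma sphere_integral_poly_inner:
  fixes u :: "real ^ 'n"
  assumes u: "norm u = 1" and d: "d = CARD('n) - 1" "d \<ge> 1"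
  shows "(\<integral>x. poly q (u \<bullet> x) \<partial>sphere_measure) = omega (d - 1) * (LINT t:{-1..1}|lborel. poly q t * weight d t)"
proof -
  have "(\<integral>x. poly q (u \<bullet> x) \<partial>sphere_measure) = (\<Sum>i\<le>degree q. \<integral>x. coeff q i * (u \<bullet> x) ^ i \<partial>sphere_measure)"
    unfolding poly_altdef
    by (intro Bochner_Integration.integral_sum integrable_sphere_measure continuous_intros)
  also have "\<dots> = omega (d - 1) * (\<Sum>i\<le>degree q. LINT t:{-1..1}|lborel. coeff q i * (t ^ i * weight d t))"
    by (simp add: sphere_moment_eq_weight_moment[OF assms] sum_distrib_left mult.left_commute)
  also have "(\<Sum>i\<le>degree q. LINT t:{-1..1}|lborel. coeff q i * (t ^ i * weight d t))
      = (LINT t:{-1..1}|lborel. (\<Sum>i\<le>degree q. coeff q i * (t ^ i * weight d t)))"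
    unfolding set_lebesgue_integral_def scaleR_sum_right
    by (rule Bochner_Integration.integral_sum[symmetric], fold set_integrable_def)
       (intro set_integrable_mult_right set_integrable_weight d continuous_intros order_refl)
  also have "\<dots> = (LINT t:{-1..1}|lborel. poly q t * weight d t)"
    by (simp add: poly_altdef sum_distrib_right mult.assoc)
  finally show ?thesis .
qed

text \<open>Outside [-1,1] \<open>arccos\<close> is the description of an unsatisfiable predicate,
  so it has one constant value there.\<close>

lemma borel_measurable_arccos: "arccos \<in> borel_measurable borel"
proof -
  have "arccos x = (if x \<in> {-1..1} then arccos x else (THE _. False))" for x
    using cos_le_one cos_ge_minus_one by (auto simp: arccos_def intro!: arg_cong[where f = The])
  moreover have "(\<lambda>x. if x \<in> {-1..1} then arccos x else (THE _. False)) \<in> borel_measurable borel"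
    by (intro borel_measurable_continuous_on_if continuous_on_arccos' continuous_on_const) auto
  ultimately show ?thesis by presburger
qed

lemma borel_measurable_gegen_tilde: "gegen_tilde d k \<in> borel_measurable borel"
proof -
  have "gegen_d d k \<in> borel_measurable borel"
  proof (cases "d = 1")
    case True
    note [measurable] = borel_measurable_arccos
    show ?thesis unfolding gegen_d_def using True by simp
  next
    case False
    then have "gegen_d d k = poly (gegen_poly ((real d - 1) / 2) k)"
      by (simp add: gegen_d_def poly_gegen_poly fun_eq_iff)
    then show ?thesis
      by (auto intro!: borel_measurable_continuous_onI continuous_intros continuous_on_poly)
  qed
  then show ?thesis unfolding gegen_tilde_def by measurable
qed

section \<open>The projected distribution\<close>

theorem theorem6:
  fixes M :: "'w measure" and X :: "'w \<Rightarrow> real ^ 'n"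
    and mu gamma :: "real ^ 'n" and rho :: real and k :: nat
  defines "d \<equiv> CARD('n) - 1"
  assumes "CARD('n) \<ge> 2"
    and "k \<ge> 1"
    and "mu \<in> sphere 0 1" and "gamma \<in> sphere 0 1"
    and "rho \<in> {-1..1}"
    and "prob_space M"
    and "X \<in> measurable M borel"
    and "distr M borel X = C_dist k mu rho"
  shows "(distr M borel (\<lambda>w. gamma \<bullet> X w) =
           density lborel (\<lambda>x. ennreal (indicator {-1..1} x *
              (f_d d x * (1 + rho * gegen_tilde d k (gamma \<bullet> mu) * gegen_tilde d k x))))) \<and>
         (\<forall>x\<in>{-1..1}. measure M {w \<in> space M. gamma \<bullet> X w \<le> x}
           = F_d d x - rho * eta d k (gamma \<bullet> mu) * G d k x)"
proof -
  have d: "d = CARD('n) - 1" "d \<ge> 1" using assms(2) by (auto simp: d_def)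
  have k: "k \<ge> 1" by fact
  have unit: "norm gamma = 1" "norm mu = 1" using assms(4,5) by auto
  interpret M: prob_space M by fact
  have X [measurable]: "X \<in> borel_measurable M" by fact
  define P where "P = gegen_d_poly d k"
  define s where "s = gamma \<bullet> mu"
  define p1 where "p1 = poly P 1"
  have p1: "p1 \<noteq> 0" unfolding p1_def P_def by (rule gegen_d_poly_1_nonzero[OF d(2) k])
  have inner_range: "u \<bullet> x \<in> {-1..1}" if "norm u = 1" "norm x = 1" for u x :: "real ^ 'n"
    using Cauchy_Schwarz_ineq2[of u x] that by auto
  have AE_inner: "AE x in sphere_measure. u \<bullet> x \<in> {-1..1}" if "norm u = 1" for u :: "real ^ 'n"
    using AE_sphere_measure by eventually_elim (rule inner_range[OF that])
  have s: "s \<in> {-1..1}" unfolding s_def by (rule inner_range[OF unit])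
  have tilde: "gegen_tilde d k t = poly P t / p1" if "t \<in> {-1..1}" for t
    using that by (simp add: gegen_tilde_def gegen_d_eq_poly P_def p1_def)
  have om: "omega d > 0" "omega (d - 1) > 0" by (rule omega_pos)+
  note [measurable] = borel_measurable_gegen_tilde
  \<comment> \<open>Used with rho for the density on the sphere and with the product
    \<open>a\<close> for the projected density.\<close>
  have tilde_ge: "1 + a * gegen_tilde d k t \<ge> 0" if "\<bar>a\<bar> \<le> 1" "t \<in> {-1..1}" for a t
  proof -
    have "\<bar>a * gegen_tilde d k t\<bar> \<le> 1"
      using gegen_tilde_abs_le_1[OF d(2) k that(2)] that(1) by (simp add: abs_mult mult_le_one)
    then show ?thesis by linarith
  qed
  define a where "a = rho * gegen_tilde d k s"
  have a: "\<bar>a\<bar> \<le> 1"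
    using gegen_tilde_abs_le_1[OF d(2) k s] assms(6) by (auto simp: a_def abs_mult intro!: mult_le_one)

  define dens where "dens x = indicator {-1..1} x * (f_d d x * (1 + rho * gegen_tilde d k s * gegen_tilde d k x))" for x
  have f_d_meas [measurable]: "f_d d \<in> borel_measurable borel"
    unfolding f_d_def by measurable
  have dens_meas [measurable]: "dens \<in> borel_measurable borel"
    unfolding dens_def by measurable
  have dens_nonneg: "dens x \<ge> 0" for x
    using tilde_ge[OF a] om by (auto simp: dens_def indicator_def f_d_def a_def[symmetric])
  have dens_eq: "dens x = indicator {-1..1} x * (omega (d - 1) / omega d * ((1 + a / p1 * poly P x) * weight d x))" for x
    using tilde by (auto simp: dens_def indicator_def f_d_def a_def)
  have dens_int: "integrable lborel (\<lambda>x. dens x * g x)" if "continuous_on UNIV g" for g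
  proof -
    have "set_integrable lborel {-1..1} (\<lambda>x. (omega (d - 1) / omega d * (1 + a / p1 * poly P x) * g x) * weight d x)"
      by (intro set_integrable_weight d continuous_intros continuous_on_poly that) auto
    then show ?thesis
      unfolding set_integrable_def dens_eq by (simp add: mult_ac)
  qed

  define N1 where "N1 = distr (C_dist k mu rho) borel (\<lambda>x. gamma \<bullet> x)"
  define N2 where "N2 = density lborel (\<lambda>x. ennreal (dens x))"
  define r where "r x = (1 + rho * gegen_tilde d k (x \<bullet> mu)) / omega d" for x
  have [measurable]: "r \<in> borel_measurable borel" unfolding r_def by measurable
  have C: "C_dist k mu rho = density sphere_measure (\<lambda>x. ennreal (r x))"
    by (simp add: C_dist_def d_def r_def Let_def)
  have setsC [simp, measurable_cong]: "sets (C_dist k mu rho) = sets borel" by (simp add: C)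
  have r_AE: "AE x in sphere_measure. 0 \<le> r x \<and> r x = (1 + rho / p1 * poly P (mu \<bullet> x)) / omega d"
    using AE_inner[OF unit(2)]
  proof eventually_elim
    case (elim x)
    then show ?case
      using tilde[OF elim] tilde_ge[OF _ elim, of rho] assms(6) om
      by (simp add: r_def inner_commute abs_le_iff)
  qed

  \<comment> \<open>The moments of the projection and those of \<open>dens\<close> are both reduced
    to one integral over the sphere in which mu occurs only through \<open>a\<close>.\<close>
  have N1_moment: "(\<integral>x. x ^ m \<partial>N1) = 1 / omega d *
      (\<integral>x. (gamma \<bullet> x) ^ m * (1 + a / p1 * poly P (gamma \<bullet> x)) \<partial>sphere_measure)" for m
  proof -
    have int: "integrable sphere_measure (\<lambda>x. (gamma \<bullet> x) ^ m * poly q (v \<bullet> x))" for q v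
      by (intro integrable_sphere_measure continuous_intros continuous_on_poly)
    have int0: "integrable sphere_measure (\<lambda>x. (gamma \<bullet> x) ^ m)"
      by (intro integrable_sphere_measure continuous_intros)
    have "(\<integral>x. x ^ m \<partial>N1) = (\<integral>x. (gamma \<bullet> x) ^ m \<partial>C_dist k mu rho)"
      unfolding N1_def by (subst integral_distr) auto
    also have "\<dots> = (\<integral>x. r x * (gamma \<bullet> x) ^ m \<partial>sphere_measure)"
      unfolding C using r_AE by (subst integral_density) auto
    also have "\<dots> = (\<integral>x. 1 / omega d * ((gamma \<bullet> x) ^ m + rho / p1 * ((gamma \<bullet> x) ^ m * poly P (mu \<bullet> x))) \<partial>sphere_measure)"
    proof (rule integral_cong_AE)
      show "AE x in sphere_measure. r x * (gamma \<bullet> x) ^ m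
          = 1 / omega d * ((gamma \<bullet> x) ^ m + rho / p1 * ((gamma \<bullet> x) ^ m * poly P (mu \<bullet> x)))"
        using r_AE
      proof eventually_elim
        case (elim x)
        then show ?case by (simp add: field_simps)
      qed
      show "(\<lambda>x. 1 / omega d * ((gamma \<bullet> x) ^ m + rho / p1 * ((gamma \<bullet> x) ^ m * poly P (mu \<bullet> x)))) \<in> borel_measurable sphere_measure"
        by (intro borel_measurable_integrable integrable_mult_right Bochner_Integration.integrable_add int int0)
    qed measurable
    also have "\<dots> = 1 / omega d * ((\<integral>x. (gamma \<bullet> x) ^ m \<partial>sphere_measure)
        + rho / p1 * (\<integral>x. (gamma \<bullet> x) ^ m * poly P (mu \<bullet> x) \<partial>sphere_measure))"
      by (simp add: int int0)
    also have "(\<integral>x. (gamma \<bullet> x) ^ m * poly P (mu \<bullet> x) \<partial>sphere_measure)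
        = poly P s / p1 * (\<integral>x. (gamma \<bullet> x) ^ m * poly P (gamma \<bullet> x) \<partial>sphere_measure)"
      unfolding s_def p1_def
      by (rule zonal_eigen_moments[OF unit d])
         (use p1 in \<open>auto simp: P_def p1_def gegen_d_poly_nonzero[OF d(2)] gegen_op_gegen_d_poly[OF d(2)]\<close>)
    also have "rho / p1 * (poly P s / p1 * (\<integral>x. (gamma \<bullet> x) ^ m * poly P (gamma \<bullet> x) \<partial>sphere_measure))
        = a / p1 * (\<integral>x. (gamma \<bullet> x) ^ m * poly P (gamma \<bullet> x) \<partial>sphere_measure)"
      by (simp add: a_def tilde[OF s])
    also have "(\<integral>x. (gamma \<bullet> x) ^ m \<partial>sphere_measure) + a / p1 * (\<integral>x. (gamma \<bullet> x) ^ m * poly P (gamma \<bullet> x) \<partial>sphere_measure)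
        = (\<integral>x. (gamma \<bullet> x) ^ m + a / p1 * ((gamma \<bullet> x) ^ m * poly P (gamma \<bullet> x)) \<partial>sphere_measure)"
      by (simp add: int int0)
    finally show ?thesis by (simp add: algebra_simps)
  qed

  have dens_moment: "(\<integral>x. dens x * x ^ m \<partial>lborel) = 1 / omega d *
      (\<integral>x. (gamma \<bullet> x) ^ m * (1 + a / p1 * poly P (gamma \<bullet> x)) \<partial>sphere_measure)" for m
  proof -
    define q where "q = monom 1 m * (1 + smult (a / p1) P)"
    have "(\<integral>x. dens x * x ^ m \<partial>lborel) = (LINT x:{-1..1}|lborel. omega (d - 1) / omega d * (poly q x * weight d x))"
      unfolding set_lebesgue_integral_def
      by (rule Bochner_Integration.integral_cong) (auto simp: dens_eq q_def poly_monom)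
    also have "\<dots> = 1 / omega d * (\<integral>x. poly q (gamma \<bullet> x) \<partial>sphere_measure)"
      by (simp add: sphere_integral_poly_inner[OF unit(1) d])
    finally show ?thesis by (simp add: q_def poly_monom)
  qed

  have N1_alt: "N1 = distr M borel (\<lambda>w. gamma \<bullet> X w)"
    unfolding N1_def assms(9)[symmetric] by (subst distr_distr) (auto simp: comp_def)
  have N1_prob: "prob_space N1"
    unfolding N1_alt by (rule M.prob_space_distr) simp
  interpret N1: prob_space N1 by (rule N1_prob)
  \<comment> \<open>The total mass of \<open>dens\<close> need not be computed: it is the zeroth
    moment, hence that of a probability measure.\<close>
  have "(\<integral>x. dens x \<partial>lborel) = 1"
    using N1_moment[of 0] dens_moment[of 0] N1.prob_space by simp
  then have "(\<integral>\<^sup>+x. ennreal (dens x) \<partial>lborel) = 1"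
    using nn_integral_eq_integral[of lborel dens] dens_int[of "\<lambda>_. 1"] dens_nonneg by simp
  then have N2_prob: "prob_space N2"
    by (intro prob_spaceI) (simp add: N2_def emeasure_density)
  have "N1 = N2"
  proof (rule real_distribution_eqI_moments[OF N1_prob N2_prob])
    show "sets N1 = sets borel" "sets N2 = sets borel" by (simp_all add: N1_def N2_def)
    have "AE x in C_dist k mu rho. gamma \<bullet> x \<in> {-1..1}"
      unfolding C using AE_inner[OF unit(1)] by (subst AE_density) (auto elim: eventually_mono)
    then show "AE x in N1. x \<in> {-1..1}"
      unfolding N1_def by (subst AE_distr_iff) auto
    show "AE x in N2. x \<in> {-1..1}"
      unfolding N2_def by (subst AE_density) (auto simp: dens_def indicator_def split: if_splits)
    show "(\<integral>x. x ^ m \<partial>N1) = (\<integral>x. x ^ m \<partial>N2)" for m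
      unfolding N1_moment dens_moment[symmetric] N2_def
      by (subst integral_density) (auto simp: dens_nonneg)
  qed
  moreover have "measure M {w \<in> space M. gamma \<bullet> X w \<le> x} = F_d d x - rho * eta d k s * G d k x"
    if x: "x \<in> {-1..1}" for x
  proof -
    have "measure M {w \<in> space M. gamma \<bullet> X w \<le> x} = measure N1 {..x}"
      unfolding N1_alt by (subst measure_distr) (auto intro!: arg_cong[where f = "measure M"])
    also have "\<dots> = (\<integral>t. indicator {..x} t \<partial>N2)"
      using \<open>N1 = N2\<close> by (simp add: N2_def)
    also have "\<dots> = (\<integral>t. dens t * indicator {..x} t \<partial>lborel)"
      unfolding N2_def by (subst integral_density) (auto simp: dens_nonneg)
    \<comment> \<open>Below -1 the density vanishes, so the integral starts there; it is split into
      the uniform part and the part with P.\<close>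
    also have "\<dots> = (LINT t:{-1..x}|lborel. f_d d t + omega (d - 1) / omega d * a / p1 * (poly P t * weight d t))"
      unfolding set_lebesgue_integral_def
      by (rule Bochner_Integration.integral_cong)
         (use x in \<open>auto simp: dens_eq indicator_def f_d_def algebra_simps\<close>)
    also have "\<dots> = F_d d x + omega (d - 1) / omega d * a / p1 * (LINT t:{-1..x}|lborel. poly P t * weight d t)"
    proof -
      have "set_integrable lborel {-1..x} (f_d d)"
        unfolding f_d_def using x by (intro set_integrable_weight d continuous_intros) auto
      moreover have "set_integrable lborel {-1..x} (\<lambda>t. poly P t * weight d t)"
        using x by (intro set_integrable_weight d continuous_on_poly continuous_on_id) auto
      ultimately show ?thesis
        unfolding F_d_def by (subst set_integral_add(2)) (auto intro: set_integrable_mult_right)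
    qed
    also have "(LINT t:{-1..x}|lborel. poly P t * weight d t) = - G d k x"
      unfolding P_def by (rule set_integral_gegen_d_poly_weight[OF d(2) k x])
    also have "omega (d - 1) / omega d * a / p1 = rho * eta d k s"
      by (simp add: a_def tilde[OF s] eta_def gegen_d_eq_poly gegen_d_eq_poly[OF s] P_def p1_def power2_eq_square mult_ac)
    finally show ?thesis by simp
  qed
  ultimately show ?thesis
    unfolding N1_alt N2_def dens_def s_def by blast
qed

end
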